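(* Let $n,m\geq 1$ be integers with $nm>2$. Then for every function $\psi:\mathbb{N}\to\mathbb{R}_{\geq 0}$ and every $\mathbf{y}\in\mathbb{R}^m$, \[ \bigl|\mathcal{A}^{\mathbf{y}}_{n,m}(\psi)\bigr| =\begin{cases} 0 & \text{if } \sum_{q=1}^\infty q^{n-1}\psi(q)^m<\infty,\\ 1 & \text{if } \sum_{q=1}^\infty q^{n-1}\psi(q)^m=\infty,\end{cases} \] where $|\cdot|$ denotes Lebesgue measure on $[0,1]^{nm}$. No monotonicity assumption is made on $\psi$.
   Context: For $\mathbf{q}=(q_1,\dots,q_n)\in\mathbb{Z}^n$ let $|\mathbf{q}|=\max_i|q_i|$. A point $\mathbf{x}\in[0,1]^{nm}$ is regarded as an $n\times m$ real matrix, and $\mathbf{q}\mathbf{x}\in\mathbb{R}^m$ denotes the product of the row vector $\mathbf{q}$ with $\mathbf{x}$. All balls are taken with respect to the maximum norm. $\mathcal{A}^{\mathbf{y}}_{n,m}(\psi)$ is the set of $\mathbf{x}\in[0,1]^{nm}$ such that there are infinitely many pairs $(\mathbf{p},\mathbf{q})\in\mathbb{Z}^m\times(\mathbb{Z}^n\setminus\{\mathbf 0\})$ with $\mathbf{q}\mathbf{x}+\mathbf{p}$ lying in the max-norm ball in $\mathbb{R}^m/\mathbb{Z}^m$ centred at $\mathbf{y}$ of radius $\psi(|\mathbf{q}|)$ (equivalently, $\max_j|(\mathbf{q}\mathbf{x}+\mathbf{p}-\mathbf{y})_j|<\psi(|\mathbf{q}|)$ for some $\mathbf p$, modulo $\mathbb{Z}^m$).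 *)

theory Defs
  imports "HOL-Analysis.Analysis"
begin

definition supnorm_int :: "int ^ 'n::finite \<Rightarrow> nat" where
  "supnorm_int q = nat (Max (range (\<lambda>i. \<bar>q $ i\<bar>)))"

definition rowmul :: "int ^ 'n::finite \<Rightarrow> real ^ 'm::finite ^ 'n \<Rightarrow> real ^ 'm" where
  "rowmul q x = (\<chi> j. \<Sum>i\<in>UNIV. of_int (q $ i) * x $ i $ j)"

definition A_set :: "(nat \<Rightarrow> real) \<Rightarrow> real ^ 'm::finite \<Rightarrow> (real ^ 'm ^ 'n::finite) set" where
  "A_set \<psi> y = {x. (\<forall>i j. 0 \<le> x $ i $ j \<and> x $ i $ j \<le> 1) \<and>
      infinite {(p :: int ^ 'm, q :: int ^ 'n). q \<noteq> 0 \<and>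
        (\<forall>j. \<bar>rowmul q x $ j + of_int (p $ j) - y $ j\<bar> < \<psi> (supnorm_int q))}}"

end

theory Submission
  imports Defs "HOL-Probability.Probability"
begin

text \<open>
  The divergence part is a second moment argument that needs neither a zero-one law nor a local
  density argument. We may assume \<open>\<psi> \<le> 1/2\<close>. Let \<open>A\<^sub>q\<close> be the set of \<open>x\<close> for which \<open>q x\<close> is
  \<open>\<psi>(|q|)\<close>-close to \<open>y\<close> modulo 1. If \<open>q\<close> and \<open>r\<close> are linearly independent, then \<open>A\<^sub>q\<close> and \<open>A\<^sub>r\<close> are
  exactly independent. If \<open>q = a u\<close> and \<open>r = b u\<close> with \<open>a > 0\<close> and \<open>b\<close> coprime, then averaging over
  translations gives \<open>|A\<^sub>q \<inter> A\<^sub>r| \<le> (4 \<psi>(|q|) \<psi>(|r|) + 2 \<psi>(|q|) / a) ^ m\<close>. By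
  \<open>(s + t) ^ m \<le> (1 + \<epsilon>) s ^ m + C t ^ m\<close> the main terms add up to at most \<open>(1 + \<epsilon>) E\<^sup>2\<close>, where \<open>E\<close> is
  the sum of the measures. For fixed \<open>q\<close>, the error terms with \<open>|r| \<le> |q|\<close> add up to
  \<open>O(\<psi>(|q|) ^ m)\<close> times the sum of \<open>a ^ (1 - m)\<close> over the divisors \<open>a\<close> of \<open>q\<close>. Among the
  vectors \<open>q\<close> of a given norm, a proportion \<open>O(a ^ (1 - n))\<close> is divisible by \<open>a\<close>, so the total
  error is \<open>O(E)\<close> as soon as the series of \<open>a ^ (2 - n - m)\<close> converges, that is, for \<open>n + m \<ge> 4\<close>, which
  is equivalent to \<open>n m > 2\<close>. Thus the variance is at most \<open>\<epsilon> E\<^sup>2 + O(E)\<close> for every \<open>\<epsilon>\<close>, and Chebyshev's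
  inequality gives full measure. The convergence part is the Borel--Cantelli lemma.
\<close>

section \<open>Periodic integrals over the unit cube\<close>

text \<open>Half-open, so that it is a fundamental domain for the integer translations: the pieces
  cut off by a shift fit back without overlap. Phrased over \<open>Basis\<close>, it serves both the
  real line and the space of matrices.\<close>

definition unit_cube :: "'a::euclidean_space set" where
  "unit_cube = {x. \<forall>b\<in>Basis. 0 \<le> x \<bullet> b \<and> x \<bullet> b < 1}"

lemma unit_cube_real: "unit_cube = {0..<1::real}"
  by (auto simp: unit_cube_def)

lemma unit_cube_measurable [measurable]: "unit_cube \<in> sets borel"
  unfolding unit_cube_def by measurable

lemma emeasure_unit_cube: "emeasure lborel (unit_cube :: 'a::euclidean_space set) = 1"
proof (rule antisym)
  have "emeasure lborel (unit_cube :: 'a set) \<le> emeasure lborel (cbox 0 One :: 'a set)"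
    by (rule emeasure_mono) (auto simp: unit_cube_def mem_box less_imp_le)
  also have "\<dots> = 1" by (subst emeasure_lborel_cbox) auto
  finally show "emeasure lborel (unit_cube :: 'a set) \<le> 1" .
  have "1 = emeasure lborel (box 0 One :: 'a set)" by (subst emeasure_lborel_box) auto
  also have "\<dots> \<le> emeasure lborel (unit_cube :: 'a set)"
    by (rule emeasure_mono) (auto simp: unit_cube_def mem_box less_imp_le)
  finally show "1 \<le> emeasure lborel (unit_cube :: 'a set)" .
qed

lemma nn_integral_lborel_translate:
  fixes f :: "'a::euclidean_space \<Rightarrow> ennreal"
  assumes [measurable]: "f \<in> borel_measurable borel"
  shows "(\<integral>\<^sup>+x. f (x + c) \<partial>lborel) = (\<integral>\<^sup>+x. f x \<partial>lborel)"
proof -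
  have "(\<integral>\<^sup>+x. f x \<partial>lborel) = (\<integral>\<^sup>+x. f x \<partial>distr lborel borel ((+) c))"
    by (simp add: lborel_distr_plus)
  also have "\<dots> = (\<integral>\<^sup>+x. f (c + x) \<partial>lborel)"
    by (subst nn_integral_distr) auto
  finally show ?thesis by (simp add: add.commute)
qed

lemma periodic_int_shift:
  fixes f :: "'a::real_vector \<Rightarrow> 'b"
  assumes "\<And>x. f (x + b) = f x"
  shows "f (x + real_of_int k *\<^sub>R b) = f x"
proof (induction k arbitrary: x rule: int_induct [where k = 0])
  case (step1 i)
  have "f (x + real_of_int (i + 1) *\<^sub>R b) = f ((x + real_of_int i *\<^sub>R b) + b)"
    by (simp add: algebra_simps)
  then show ?case using assms step1 by metis
next
  case (step2 i)
  have "f (x + real_of_int (i - 1) *\<^sub>R b) = f ((x + real_of_int (i - 1) *\<^sub>R b) + b)"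
    using assms by metis
  also have "\<dots> = f (x + real_of_int i *\<^sub>R b)" by (simp add: algebra_simps)
  finally show ?case using step2 by simp
qed simp

text \<open>The cube shifted by the fractional part \<open>s\<close> of \<open>t\<close> consists of
  the slab from \<open>s\<close> to 1 and the slab from 1 to \<open>1 + s\<close>; periodicity moves
  the second one back to the slab from 0 to \<open>s\<close>.\<close>

lemma nn_integral_periodic_shift_Basis:
  fixes f :: "'a::euclidean_space \<Rightarrow> ennreal"
  assumes [measurable]: "f \<in> borel_measurable borel"
    and per: "\<And>x. f (x + b) = f x" and b: "b \<in> Basis"
  shows "(\<integral>\<^sup>+x\<in>unit_cube. f (x + t *\<^sub>R b) \<partial>lborel) = (\<integral>\<^sup>+x\<in>unit_cube. f x \<partial>lborel)"
proof -
  define s where "s = frac t"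
  have s: "0 \<le> s" "s < 1" by (auto simp: s_def frac_lt_1)
  have shift: "f (x + t *\<^sub>R b) = f (x + s *\<^sub>R b)" for x
    using periodic_int_shift[where f = f and b = b and x = "x + s *\<^sub>R b" and k = "\<lfloor>t\<rfloor>", OF per]
    by (simp add: s_def frac_def algebra_simps)
  define slab where "slab \<alpha> \<beta> = {x::'a. \<alpha> \<le> x \<bullet> b \<and> x \<bullet> b < \<beta> \<and>
      (\<forall>b'\<in>Basis - {b}. 0 \<le> x \<bullet> b' \<and> x \<bullet> b' < 1)}" for \<alpha> \<beta>
  have [measurable]: "slab \<alpha> \<beta> \<in> sets borel" for \<alpha> \<beta> unfolding slab_def by measurable
  have cube: "unit_cube = slab 0 1" using b by (auto simp: slab_def unit_cube_def)
  have inb: "(x + u *\<^sub>R b) \<bullet> b = x \<bullet> b + u" for x u using b by (simp add: inner_left_distrib)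
  have inb': "(x + u *\<^sub>R b) \<bullet> b' = x \<bullet> b'" if "b' \<in> Basis - {b}" for x u b'
    using b that by (auto simp: inner_left_distrib inner_Basis)
  have slab_shift: "x + u *\<^sub>R b \<in> slab (\<alpha> + u) (\<beta> + u) \<longleftrightarrow> x \<in> slab \<alpha> \<beta>" for x u \<alpha> \<beta>
    using inb' by (auto simp: slab_def inb)
  have tr: "(\<integral>\<^sup>+x\<in>slab (\<alpha> + u) (\<beta> + u). f x \<partial>lborel) = (\<integral>\<^sup>+x\<in>slab \<alpha> \<beta>. f (x + u *\<^sub>R b) \<partial>lborel)" for \<alpha> \<beta> u
    by (subst nn_integral_lborel_translate[of _ "u *\<^sub>R b", symmetric])
       (auto simp: slab_shift indicator_def intro!: nn_integral_cong)
  have split: "(\<integral>\<^sup>+x\<in>slab \<alpha> \<gamma>. f x \<partial>lborel)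
      = (\<integral>\<^sup>+x\<in>slab \<alpha> \<beta>. f x \<partial>lborel) + (\<integral>\<^sup>+x\<in>slab \<beta> \<gamma>. f x \<partial>lborel)"
    if "\<alpha> \<le> \<beta>" "\<beta> \<le> \<gamma>" for \<alpha> \<beta> \<gamma>
    using that
    by (subst nn_integral_add[symmetric])
       (auto simp: slab_def indicator_def intro!: nn_integral_cong)
  have "(\<integral>\<^sup>+x\<in>unit_cube. f (x + t *\<^sub>R b) \<partial>lborel) = (\<integral>\<^sup>+x\<in>slab 0 1. f (x + s *\<^sub>R b) \<partial>lborel)"
    by (simp add: cube shift)
  also have "\<dots> = (\<integral>\<^sup>+x\<in>slab (0 + s) (1 + s). f x \<partial>lborel)" by (rule tr[symmetric])
  also have "\<dots> = (\<integral>\<^sup>+x\<in>slab s 1. f x \<partial>lborel) + (\<integral>\<^sup>+x\<in>slab (0 + 1) (s + 1). f x \<partial>lborel)"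
    using split[of s 1 "1 + s"] s by (simp add: add.commute)
  also have "(\<integral>\<^sup>+x\<in>slab (0 + 1) (s + 1). f x \<partial>lborel) = (\<integral>\<^sup>+x\<in>slab 0 s. f x \<partial>lborel)"
    unfolding tr using per by simp
  also have "(\<integral>\<^sup>+x\<in>slab s 1. f x \<partial>lborel) + (\<integral>\<^sup>+x\<in>slab 0 s. f x \<partial>lborel) = (\<integral>\<^sup>+x\<in>slab 0 1. f x \<partial>lborel)"
    using split[of 0 s 1] s by (simp add: add.commute)
  finally show ?thesis by (simp add: cube)
qed

text \<open>One coordinate direction at a time: the function already shifted along \<open>B\<close>
  is still periodic, so the one-direction case applies again.\<close>

lemma nn_integral_periodic_shift:
  fixes f :: "'a::euclidean_space \<Rightarrow> ennreal"
  assumes f [measurable]: "f \<in> borel_measurable borel"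
    and per: "\<And>x b. b \<in> Basis \<Longrightarrow> f (x + b) = f x"
  shows "(\<integral>\<^sup>+x\<in>unit_cube. f (x + c) \<partial>lborel) = (\<integral>\<^sup>+x\<in>unit_cube. f x \<partial>lborel)"
proof -
  have "(\<integral>\<^sup>+x\<in>unit_cube. f (x + (\<Sum>b\<in>B. (c \<bullet> b) *\<^sub>R b)) \<partial>lborel) = (\<integral>\<^sup>+x\<in>unit_cube. f x \<partial>lborel)"
    if "finite B" "B \<subseteq> Basis" for B
    using that
  proof (induction B rule: finite_induct)
    case (insert b B)
    define g where "g x = f (x + (\<Sum>b\<in>B. (c \<bullet> b) *\<^sub>R b))" for x
    have [measurable]: "g \<in> borel_measurable borel" unfolding g_def by measurable
    have "g (x + b) = g x" for x
      using per[of b "x + (\<Sum>b\<in>B. (c \<bullet> b) *\<^sub>R b)"] insert.prems by (simp add: g_def add_ac)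
    then have "(\<integral>\<^sup>+x\<in>unit_cube. g (x + (c \<bullet> b) *\<^sub>R b) \<partial>lborel) = (\<integral>\<^sup>+x\<in>unit_cube. g x \<partial>lborel)"
      using insert.prems by (intro nn_integral_periodic_shift_Basis) auto
    then show ?case using insert by (simp add: g_def add_ac)
  qed simp
  from this[of Basis] show ?thesis by (simp add: euclidean_representation)
qed

text \<open>No shift by a multiple of \<open>v\<close> changes the integral, so averaging over
  \<open>z\<close> costs nothing, and Fubini moves the average inside. Integrals over the cube thus
  reduce to one-dimensional ones in a freely chosen direction.\<close>

lemma nn_integral_periodic_average:
  fixes f :: "'a::euclidean_space \<Rightarrow> ennreal"
  assumes f [measurable]: "f \<in> borel_measurable borel"
    and per: "\<And>x b. b \<in> Basis \<Longrightarrow> f (x + b) = f x"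
  shows "(\<integral>\<^sup>+x\<in>unit_cube. f x \<partial>lborel) =
    (\<integral>\<^sup>+x\<in>unit_cube. (\<integral>\<^sup>+z\<in>{0..<1}. f (x + z *\<^sub>R v) \<partial>lborel) \<partial>lborel)"
proof -
  have "(\<integral>\<^sup>+x\<in>unit_cube. f x \<partial>lborel)
      = (\<integral>\<^sup>+z\<in>{0..<1::real}. (\<integral>\<^sup>+x\<in>unit_cube. f x \<partial>lborel) \<partial>lborel)"
    by (simp add: nn_integral_cmult)
  also have "\<dots> = (\<integral>\<^sup>+z\<in>{0..<1}. (\<integral>\<^sup>+x\<in>unit_cube. f (x + z *\<^sub>R v) \<partial>lborel) \<partial>lborel)"
    by (subst nn_integral_periodic_shift[OF f per]) auto
  also have "\<dots> = (\<integral>\<^sup>+z. (\<integral>\<^sup>+x. f (x + z *\<^sub>R v) * indicator unit_cube x * indicator {0..<1} z \<partial>lborel) \<partial>lborel)"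
    by (intro nn_integral_cong nn_integral_multc[symmetric]) measurable
  also have "\<dots> = (\<integral>\<^sup>+x. (\<integral>\<^sup>+z. f (x + z *\<^sub>R v) * indicator unit_cube x * indicator {0..<1} z \<partial>lborel) \<partial>lborel)"
    by (rule lborel_pair.Fubini') measurable
  also have "\<dots> = (\<integral>\<^sup>+x\<in>unit_cube. (\<integral>\<^sup>+z\<in>{0..<1}. f (x + z *\<^sub>R v) \<partial>lborel) \<partial>lborel)"
    by (subst nn_integral_multc[symmetric]) (auto simp: mult_ac intro!: nn_integral_cong)
  finally show ?thesis .
qed

section \<open>Overlap estimates in a single column\<close>

text \<open>The preimage in the real line of a ball in R/Z. Being 1-periodic, it fits the averaging
  argument.\<close>

definition mod1_ball :: "real \<Rightarrow> real \<Rightarrow> real set" where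
  "mod1_ball c \<rho> = {t. \<exists>p::int. \<bar>t + of_int p - c\<bar> < \<rho>}"

lemma open_mod1_ball: "open (mod1_ball c \<rho>)"
proof -
  have "mod1_ball c \<rho> = (\<Union>p::int. {t. \<bar>t + of_int p - c\<bar> < \<rho>})" by (auto simp: mod1_ball_def)
  also have "open \<dots>" by (intro open_UN ballI open_Collect_less continuous_intros)
  finally show ?thesis .
qed

lemma mod1_ball_measurable [measurable]: "mod1_ball c \<rho> \<in> sets borel"
  by (rule borel_open) (rule open_mod1_ball)

lemma mod1_ball_add_of_int [simp]: "t + of_int k \<in> mod1_ball c \<rho> \<longleftrightarrow> t \<in> mod1_ball c \<rho>"
proof
  assume "t + of_int k \<in> mod1_ball c \<rho>"
  then obtain p :: int where "\<bar>t + of_int k + of_int p - c\<bar> < \<rho>" by (auto simp: mod1_ball_def)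
  then have "\<bar>t + of_int (k + p) - c\<bar> < \<rho>" by (simp add: algebra_simps)
  then show "t \<in> mod1_ball c \<rho>" unfolding mod1_ball_def by blast
next
  assume "t \<in> mod1_ball c \<rho>"
  then obtain p :: int where "\<bar>t + of_int p - c\<bar> < \<rho>" by (auto simp: mod1_ball_def)
  then have "\<bar>(t + of_int k) + of_int (p - k) - c\<bar> < \<rho>" by (simp add: algebra_simps)
  then show "t + of_int k \<in> mod1_ball c \<rho>" unfolding mod1_ball_def by blast
qed

lemma nn_integral_indicator_unit_shift:
  fixes S :: "real set"
  assumes [measurable]: "S \<in> sets borel" and per: "\<And>t k. t + of_int k \<in> S \<longleftrightarrow> t \<in> S"
  shows "(\<integral>\<^sup>+z\<in>{0..<1}. indicator S (c + z) \<partial>lborel) = emeasure lborel (S \<inter> {0..<1})"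
proof -
  have "(\<integral>\<^sup>+z\<in>unit_cube. indicator S (z + c) \<partial>lborel)
      = (\<integral>\<^sup>+z\<in>unit_cube. (indicator S z :: ennreal) \<partial>lborel)"
    using per[of _ 1] by (intro nn_integral_periodic_shift) (auto simp: indicator_def)
  then show ?thesis
    by (simp add: unit_cube_real add.commute flip: indicator_inter_arith)
qed

text \<open>Measured in the period whose midpoint is \<open>c\<close>, the ball is a single
  interval: \<open>\<rho> \<le> 1 / 2\<close> keeps it from wrapping around.\<close>

lemma emeasure_mod1_ball:
  assumes "0 \<le> \<rho>" "\<rho> \<le> 1 / 2"
  shows "emeasure lborel (mod1_ball c \<rho> \<inter> {0..<1}) = ennreal (2 * \<rho>)"
proof -
  have eq: "(c - 1 / 2) + z \<in> mod1_ball c \<rho> \<longleftrightarrow> z \<in> {1 / 2 - \<rho><..<1 / 2 + \<rho>}" if z: "z \<in> {0..<1}" for z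
  proof
    assume "(c - 1 / 2) + z \<in> mod1_ball c \<rho>"
    then obtain p :: int where p: "\<bar>z - 1 / 2 + of_int p\<bar> < \<rho>" by (auto simp: mod1_ball_def algebra_simps)
    have "real_of_int p < 1" "real_of_int p > -1" using p assms z by auto
    then have "p = 0" by linarith
    with p show "z \<in> {1 / 2 - \<rho><..<1 / 2 + \<rho>}" by auto
  next
    assume "z \<in> {1 / 2 - \<rho><..<1 / 2 + \<rho>}"
    then have "\<bar>(c - 1 / 2) + z + of_int 0 - c\<bar> < \<rho>" by auto
    then show "(c - 1 / 2) + z \<in> mod1_ball c \<rho>" unfolding mod1_ball_def by blast
  qed
  have "emeasure lborel (mod1_ball c \<rho> \<inter> {0..<1})
      = (\<integral>\<^sup>+z\<in>{0..<1}. indicator (mod1_ball c \<rho>) ((c - 1 / 2) + z) \<partial>lborel)"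
    by (rule nn_integral_indicator_unit_shift[symmetric]) auto
  also have "\<dots> = (\<integral>\<^sup>+z. indicator {1 / 2 - \<rho><..<1 / 2 + \<rho>} z \<partial>lborel)"
    using assms by (intro nn_integral_cong) (auto simp: indicator_def eq)
  also have "\<dots> = ennreal (2 * \<rho>)" using assms by simp
  finally show ?thesis .
qed

lemma card_int_open_interval:
  fixes \<alpha> L :: real
  assumes "L \<ge> 0"
  shows "finite {N::int. \<alpha> < of_int N \<and> of_int N < \<alpha> + L}" (is "finite ?A")
    and "real (card {N::int. \<alpha> < of_int N \<and> of_int N < \<alpha> + L}) \<le> L + 1"
proof -
  have sub: "?A \<subseteq> {\<lfloor>\<alpha>\<rfloor> + 1..\<lceil>\<alpha> + L\<rceil> - 1}" by (auto simp: floor_less_iff less_ceiling_iff) linarith+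
  show "finite ?A" using sub by (rule finite_subset) simp
  have "card ?A \<le> card {\<lfloor>\<alpha>\<rfloor> + 1..\<lceil>\<alpha> + L\<rceil> - 1}" using sub by (intro card_mono) auto
  also have "\<dots> = nat (\<lceil>\<alpha> + L\<rceil> - 1 - \<lfloor>\<alpha>\<rfloor>)" by simp
  finally have "real (card ?A) \<le> real (nat (\<lceil>\<alpha> + L\<rceil> - 1 - \<lfloor>\<alpha>\<rfloor>))" by linarith
  also have "\<dots> \<le> L + 1" using assms by linarith
  finally show "real (card ?A) \<le> L + 1" .
qed

text \<open>Each counted \<open>k\<close> has an integer \<open>p k\<close> for which
  \<open>b * k + a * p k\<close> lies in an open interval of length \<open>2 * \<rho> * a\<close>.
  By coprimality the residues of \<open>b * k\<close> modulo \<open>a\<close> are distinct for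
  \<open>k < a\<close>, so these integers are distinct, and the interval holds at most
  \<open>2 * \<rho> * a + 1\<close> of them.\<close>

lemma card_progression_mod1_ball:
  fixes a :: nat and b :: int
  assumes a: "a > 0" and cop: "coprime (int a) b" and \<rho>: "\<rho> \<ge> 0"
  shows "real (card {k \<in> {..<a}. s + of_int b * real k / real a \<in> mod1_ball c \<rho>}) \<le> 2 * \<rho> * real a + 1"
proof -
  let ?K = "{k \<in> {..<a}. s + of_int b * real k / real a \<in> mod1_ball c \<rho>}"
  let ?N = "{N::int. (c - s - \<rho>) * a < of_int N \<and> of_int N < (c - s - \<rho>) * a + 2 * \<rho> * real a}"
  have ex: "\<forall>k\<in>?K. \<exists>p::int. \<bar>s + of_int b * real k / real a + of_int p - c\<bar> < \<rho>"
    by (auto simp: mod1_ball_def)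
  obtain p :: "nat \<Rightarrow> int" where
    p: "\<And>k. k \<in> ?K \<Longrightarrow> \<bar>s + of_int b * real k / real a + of_int (p k) - c\<bar> < \<rho>"
    using bchoice[OF ex] by blast
  define g where "g k = b * int k + p k * int a" for k
  have "inj_on g ?K"
  proof (rule inj_onI)
    fix k l assume kl: "k \<in> ?K" "l \<in> ?K" and eq: "g k = g l"
    have "b * (int k - int l) = int a * (p l - p k)" using eq by (simp add: g_def algebra_simps)
    then have "int a dvd b * (int k - int l)" by (metis dvd_triv_left)
    then have "int a dvd int k - int l" using cop by (simp add: coprime_dvd_mult_right_iff)
    moreover have "\<bar>int k - int l\<bar> < int a" using kl by auto
    ultimately have "int k - int l = 0" using dvd_imp_le_int[of "int k - int l" "int a"] by fastforce
    then show "k = l" by simp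
  qed
  moreover have "g ` ?K \<subseteq> ?N"
  proof
    fix N assume "N \<in> g ` ?K"
    then obtain k where k: "k \<in> ?K" and N: "N = g k" by auto
    have "of_int N = (of_int b * real k / real a + of_int (p k)) * real a"
      using a by (simp add: N g_def field_simps)
    moreover have "c - s - \<rho> < of_int b * real k / real a + of_int (p k)"
      "of_int b * real k / real a + of_int (p k) < c - s + \<rho>" using p[OF k] by auto
    ultimately have "(c - s - \<rho>) * real a < of_int N" "of_int N < (c - s + \<rho>) * real a"
      using a by (simp_all only: mult_strict_right_mono of_nat_0_less_iff)
    moreover have "(c - s + \<rho>) * real a = (c - s - \<rho>) * real a + 2 * \<rho> * real a"
      by (simp add: ring_distribs)
    ultimately show "N \<in> ?N" by simp
  qed
  ultimately have "card ?K \<le> card ?N"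
    using card_int_open_interval(1)[of "2 * \<rho> * real a"] \<rho> by (intro card_inj_on_le) auto
  then show ?thesis using card_int_open_interval(2)[of "2 * \<rho> * real a" "(c - s - \<rho>) * a"] \<rho>
    by simp
qed

section \<open>Translations of a single column and averaging along them\<close>

definition column_vec :: "'m::finite \<Rightarrow> real ^ 'n::finite \<Rightarrow> real ^ 'm ^ 'n" where
  "column_vec j w = (\<chi> i j'. if j' = j then w $ i else 0)"

lemma rowmul_add_column:
  "rowmul q (x + z *\<^sub>R column_vec j w) $ j' =
    rowmul q x $ j' + (if j' = j then z * (\<Sum>i\<in>UNIV. of_int (q $ i) * w $ i) else 0)"
proof -
  have "rowmul q (x + z *\<^sub>R column_vec j w) $ j' = rowmul q x $ j' +
      (\<Sum>i\<in>UNIV. of_int (q $ i) * (z * (if j' = j then w $ i else 0)))"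
    by (simp add: rowmul_def column_vec_def distrib_left sum.distrib)
  also have "(\<Sum>i\<in>UNIV. of_int (q $ i) * (z * (if j' = j then w $ i else 0)))
      = (if j' = j then z * (\<Sum>i\<in>UNIV. of_int (q $ i) * w $ i) else 0)"
    by (auto simp: sum_distrib_left intro!: sum.cong)
  finally show ?thesis .
qed

lemma Basis_column_vec:
  assumes "b \<in> (Basis :: (real ^ 'm::finite ^ 'n::finite) set)"
  obtains i j where "b = column_vec j (axis i 1)"
proof -
  obtain i j where "b = axis i (axis j 1)" using assms by (auto simp: Basis_vec_def)
  also have "axis i (axis j 1) = column_vec j (axis i 1)"
    by (auto simp: vec_eq_iff column_vec_def axis_def)
  finally show ?thesis using that by blast
qed

lemma sum_mult_axis: "(\<Sum>i\<in>UNIV. f i * (axis k c $ i)) = f k * (c::real)"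
  by (simp add: axis_def if_distrib sum.delta cong: if_cong)

lemma rowmul_add_Basis_mem:
  fixes S :: "real set"
  assumes b: "b \<in> Basis" and per: "\<And>t k. t + of_int k \<in> S \<longleftrightarrow> t \<in> S"
  shows "rowmul q (x + b) $ j \<in> S \<longleftrightarrow> rowmul q x $ j \<in> S"
proof -
  obtain i j' where bij: "b = column_vec j' (axis i 1)" using Basis_column_vec[OF b] .
  have "rowmul q (x + b) $ j = rowmul q x $ j + of_int (if j = j' then q $ i else 0)"
    using rowmul_add_column[of q x 1 j' "axis i 1" j] by (simp add: bij sum_mult_axis)
  then show ?thesis using per by metis
qed

lemma rowmul_nth_measurable [measurable]:
  "(\<lambda>x::real ^ 'm::finite ^ 'n::finite. rowmul q x $ j) \<in> borel_measurable borel"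
  by (intro borel_measurable_continuous_onI) (auto simp: rowmul_def intro!: continuous_intros)

text \<open>Along \<open>column_vec j w\<close> the coordinate \<open>rowmul q x $ j\<close> moves
  at unit speed while \<open>h\<close> stays constant, so the average over one period of
  \<open>z\<close> is the measure of \<open>S\<close> in one period. The factor \<open>h\<close>
  carries all conditions that do not notice this direction.\<close>

lemma nn_integral_column_average:
  fixes h :: "real ^ 'm::finite ^ 'n::finite \<Rightarrow> ennreal"
  assumes [measurable]: "S \<in> sets borel" "h \<in> borel_measurable borel"
    and S: "\<And>t k. t + of_int k \<in> S \<longleftrightarrow> t \<in> S"
    and h: "\<And>x b. b \<in> Basis \<Longrightarrow> h (x + b) = h x"
    and hw: "\<And>x z. h (x + z *\<^sub>R column_vec j w) = h x"
    and w: "(\<Sum>i\<in>UNIV. of_int (q $ i) * w $ i) = 1"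
  shows "(\<integral>\<^sup>+x\<in>unit_cube. indicator S (rowmul q x $ j) * h x \<partial>lborel) =
    emeasure lborel (S \<inter> {0..<1}) * (\<integral>\<^sup>+x\<in>unit_cube. h x \<partial>lborel)"
proof -
  have "(\<integral>\<^sup>+x\<in>unit_cube. indicator S (rowmul q x $ j) * h x \<partial>lborel)
    = (\<integral>\<^sup>+x\<in>unit_cube. (\<integral>\<^sup>+z\<in>{0..<1}. indicator S (rowmul q (x + z *\<^sub>R column_vec j w) $ j)
        * h (x + z *\<^sub>R column_vec j w) \<partial>lborel) \<partial>lborel)"
    by (rule nn_integral_periodic_average)
       (auto simp: h indicator_def rowmul_add_Basis_mem[OF _ S])
  also have "\<dots> = (\<integral>\<^sup>+x\<in>unit_cube. emeasure lborel (S \<inter> {0..<1}) * h x \<partial>lborel)"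
  proof (intro nn_integral_cong arg_cong2[where f = "(*)"] refl)
    fix x :: "real ^ 'm ^ 'n"
    have "(\<integral>\<^sup>+z\<in>{0..<1}. indicator S (rowmul q (x + z *\<^sub>R column_vec j w) $ j)
        * h (x + z *\<^sub>R column_vec j w) \<partial>lborel)
      = (\<integral>\<^sup>+z. h x * (indicator S (rowmul q x $ j + z) * indicator {0..<1} z) \<partial>lborel)"
      by (intro nn_integral_cong, simp add: hw rowmul_add_column w) (simp only: mult_ac)
    also have "\<dots> = h x * emeasure lborel (S \<inter> {0..<1})"
      by (subst nn_integral_cmult) (auto simp: nn_integral_indicator_unit_shift S)
    finally show "(\<integral>\<^sup>+z\<in>{0..<1}. indicator S (rowmul q (x + z *\<^sub>R column_vec j w) $ j)
        * h (x + z *\<^sub>R column_vec j w) \<partial>lborel) = emeasure lborel (S \<inter> {0..<1}) * h x"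
      by (simp add: mult.commute)
  qed
  also have "\<dots> = emeasure lborel (S \<inter> {0..<1}) * (\<integral>\<^sup>+x\<in>unit_cube. h x \<partial>lborel)"
    by (subst nn_integral_cmult[symmetric]) (auto simp: mult.assoc)
  finally show ?thesis .
qed

lemma obtain_dual_vec:
  fixes q :: "int ^ 'n::finite"
  assumes "q \<noteq> 0"
  obtains w :: "real ^ 'n" where "(\<Sum>i\<in>UNIV. of_int (q $ i) * w $ i) = 1"
proof -
  obtain i where "q $ i \<noteq> 0" using assms by (auto simp: vec_eq_iff)
  then have "(\<Sum>l\<in>UNIV. of_int (q $ l) * axis i (1 / of_int (q $ i)) $ l) = (1::real)"
    by (simp add: sum_mult_axis)
  then show ?thesis by (rule that)
qed

text \<open>A nonzero 2 by 2 minor yields a direction that moves the condition on \<open>q\<close>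
  and fixes the one on \<open>r\<close>. Averaging along it splits off \<open>S\<close>; a second
  average, along a vector dual to \<open>r\<close>, splits off \<open>T\<close>.\<close>

lemma nn_integral_overlap_independent:
  fixes B :: "(real ^ 'm::finite ^ 'n::finite) set"
  assumes [measurable]: "S \<in> sets borel" "T \<in> sets borel" "B \<in> sets borel"
    and S: "\<And>t k. t + of_int k \<in> S \<longleftrightarrow> t \<in> S" and T: "\<And>t k. t + of_int k \<in> T \<longleftrightarrow> t \<in> T"
    and B: "\<And>x b. b \<in> Basis \<Longrightarrow> x + b \<in> B \<longleftrightarrow> x \<in> B"
    and Bj: "\<And>x z w. x + z *\<^sub>R column_vec j w \<in> B \<longleftrightarrow> x \<in> B"
    and r: "r \<noteq> 0" and ik: "q $ i * r $ k \<noteq> q $ k * r $ i"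
  shows "(\<integral>\<^sup>+x\<in>unit_cube. indicator S (rowmul q x $ j) * (indicator T (rowmul r x $ j) * indicator B x) \<partial>lborel)
    = emeasure lborel (S \<inter> {0..<1}) * (emeasure lborel (T \<inter> {0..<1}) *
        (\<integral>\<^sup>+x\<in>unit_cube. indicator B x \<partial>lborel))"
proof -
  define D where "D = real_of_int (q $ i * r $ k - q $ k * r $ i)"
  \<comment> \<open>Cramer's rule for the system q w = 1, r w = 0 with \<open>w\<close> supported on
    the coordinates \<open>i\<close> and \<open>k\<close>; \<open>D\<close> is the minor.\<close>
  define w :: "real ^ 'n" where "w = axis i (of_int (r $ k) / D) + axis k (- of_int (r $ i) / D)"
  have D: "D \<noteq> 0" using ik by (simp add: D_def del: of_int_diff of_int_mult)
  have wsum: "(\<Sum>l\<in>UNIV. of_int (u $ l) * w $ l)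
      = of_int (u $ i) * (of_int (r $ k) / D) + of_int (u $ k) * (- of_int (r $ i) / D)" for u :: "int ^ 'n"
    by (simp only: w_def vector_add_component distrib_left sum.distrib sum_mult_axis)
  have qw: "(\<Sum>l\<in>UNIV. of_int (q $ l) * w $ l) = 1"
    using D unfolding wsum by (simp add: divide_simps) (simp add: D_def)
  have rw: "(\<Sum>l\<in>UNIV. of_int (r $ l) * w $ l) = 0"
    unfolding wsum by simp
  obtain w' :: "real ^ 'n" where w': "(\<Sum>l\<in>UNIV. of_int (r $ l) * w' $ l) = 1"
    using obtain_dual_vec[OF r] .
  have "(\<integral>\<^sup>+x\<in>unit_cube. indicator S (rowmul q x $ j) * (indicator T (rowmul r x $ j) * indicator B x) \<partial>lborel)
    = emeasure lborel (S \<inter> {0..<1}) *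
      (\<integral>\<^sup>+x\<in>unit_cube. indicator T (rowmul r x $ j) * indicator B x \<partial>lborel)"
    by (rule nn_integral_column_average[where w = w])
       (auto simp: S qw rw rowmul_add_column indicator_def B Bj rowmul_add_Basis_mem[OF _ T])
  also have "(\<integral>\<^sup>+x\<in>unit_cube. indicator T (rowmul r x $ j) * indicator B x \<partial>lborel)
    = emeasure lborel (T \<inter> {0..<1}) * (\<integral>\<^sup>+x\<in>unit_cube. indicator B x \<partial>lborel)"
    by (rule nn_integral_column_average[where w = w'])
       (auto simp: T w' indicator_def B Bj)
  finally show ?thesis .
qed

text \<open>Translating column \<open>j\<close> by \<open>k / a\<close> times a vector dual to \<open>u\<close> fixes \<open>q x\<close> modulo 1 and moves
  \<open>r x\<close> by \<open>b k / a\<close>. Averaging over \<open>k < a\<close> turns the second condition into counting points of a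
  progression that is equidistributed modulo 1.\<close>

lemma nn_integral_overlap_parallel:
  fixes B :: "(real ^ 'm::finite ^ 'n::finite) set"
  assumes [measurable]: "S \<in> sets borel" "B \<in> sets borel"
    and S: "\<And>t k. t + of_int k \<in> S \<longleftrightarrow> t \<in> S"
    and B: "\<And>x b. b \<in> Basis \<Longrightarrow> x + b \<in> B \<longleftrightarrow> x \<in> B"
    and Bj: "\<And>x z w. x + z *\<^sub>R column_vec j w \<in> B \<longleftrightarrow> x \<in> B"
    and u: "u \<noteq> 0" and a: "a > 0" and cop: "coprime (int a) b" and \<rho>: "\<rho> \<ge> 0"
    and q: "\<And>i. q $ i = int a * u $ i" and r: "\<And>i. r $ i = b * u $ i"
  shows "(\<integral>\<^sup>+x\<in>unit_cube. indicator S (rowmul q x $ j) * (indicator (mod1_ball c \<rho>) (rowmul r x $ j) * indicator B x) \<partial>lborel)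
    \<le> emeasure lborel (S \<inter> {0..<1}) * (ennreal (2 * \<rho> + 1 / real a) *
        (\<integral>\<^sup>+x\<in>unit_cube. indicator B x \<partial>lborel))"
    (is "?I \<le> ?s * (_ * ?J)")
proof -
  define f :: "real ^ 'm ^ 'n \<Rightarrow> ennreal" where
    "f x = indicator S (rowmul q x $ j) * (indicator (mod1_ball c \<rho>) (rowmul r x $ j) * indicator B x)" for x
  have [measurable]: "f \<in> borel_measurable borel" unfolding f_def by measurable
  obtain w :: "real ^ 'n" where w: "(\<Sum>l\<in>UNIV. of_int (u $ l) * w $ l) = 1"
    using obtain_dual_vec[OF u] .
  have qw: "(\<Sum>l\<in>UNIV. of_int (q $ l) * w $ l) = real a"
    using w by (simp add: q mult.assoc flip: sum_distrib_left)
  have rw: "(\<Sum>l\<in>UNIV. of_int (r $ l) * w $ l) = of_int b"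
    using w by (simp add: r mult.assoc flip: sum_distrib_left)
  have q0: "q \<noteq> 0" using u a by (auto simp: vec_eq_iff q)
  obtain w' :: "real ^ 'n" where w': "(\<Sum>l\<in>UNIV. of_int (q $ l) * w' $ l) = 1"
    using obtain_dual_vec[OF q0] .
  have fk: "f (x + (real k / real a) *\<^sub>R column_vec j w) = indicator S (rowmul q x $ j) * indicator B x
      * indicator (mod1_ball c \<rho>) (rowmul r x $ j + of_int b * real k / real a)" for x k
    using a S[of "rowmul q x $ j" "int k"]
    by (simp add: f_def rowmul_add_column Bj qw rw indicator_def) (simp add: mult.commute)
  have "of_nat a * ?I = (\<Sum>k<a. \<integral>\<^sup>+x\<in>unit_cube. f x \<partial>lborel)"
    by (simp add: f_def)
  also have "\<dots> = (\<Sum>k<a. \<integral>\<^sup>+x\<in>unit_cube. f (x + (real k / real a) *\<^sub>R column_vec j w) \<partial>lborel)"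
    by (intro sum.cong refl nn_integral_periodic_shift[symmetric])
       (auto simp: f_def rowmul_add_Basis_mem[OF _ S] rowmul_add_Basis_mem[OF _ mod1_ball_add_of_int] B indicator_def)
  also have "\<dots> = (\<integral>\<^sup>+x. (\<Sum>k<a. f (x + (real k / real a) *\<^sub>R column_vec j w) * indicator unit_cube x) \<partial>lborel)"
    by (rule nn_integral_sum[symmetric]) measurable
  also have "\<dots> \<le> (\<integral>\<^sup>+x. ennreal (2 * \<rho> * real a + 1) *
      (indicator S (rowmul q x $ j) * indicator B x * indicator unit_cube x) \<partial>lborel)"
  proof (rule nn_integral_mono)
    fix x :: "real ^ 'm ^ 'n"
    have "(\<Sum>k<a. f (x + (real k / real a) *\<^sub>R column_vec j w) * indicator unit_cube x)
      = (\<Sum>k<a. indicator (mod1_ball c \<rho>) (rowmul r x $ j + of_int b * real k / real a)) *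
        (indicator S (rowmul q x $ j) * indicator B x * indicator unit_cube x)"
      unfolding fk sum_distrib_right by (intro sum.cong refl) (simp only: mult_ac)
    also have "(\<Sum>k<a. indicator (mod1_ball c \<rho>) (rowmul r x $ j + of_int b * real k / real a))
      = (of_nat (card {k \<in> {..<a}. rowmul r x $ j + of_int b * real k / real a \<in> mod1_ball c \<rho>}) :: ennreal)"
      by (simp add: indicator_def of_bool_def sum.If_cases Int_def)
    also have "\<dots> \<le> ennreal (2 * \<rho> * real a + 1)"
      unfolding ennreal_of_nat_eq_real_of_nat
      by (intro ennreal_leI card_progression_mod1_ball[OF a cop \<rho>])
    finally show "(\<Sum>k<a. f (x + (real k / real a) *\<^sub>R column_vec j w) * indicator unit_cube x)
      \<le> ennreal (2 * \<rho> * real a + 1) * (indicator S (rowmul q x $ j) * indicator B x * indicator unit_cube x)"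
      by (simp add: mult_right_mono)
  qed
  also have "\<dots> = ennreal (2 * \<rho> * real a + 1) *
      (\<integral>\<^sup>+x\<in>unit_cube. indicator S (rowmul q x $ j) * indicator B x \<partial>lborel)"
    by (rule nn_integral_cmult) measurable
  also have "(\<integral>\<^sup>+x\<in>unit_cube. indicator S (rowmul q x $ j) * indicator B x \<partial>lborel) = ?s * ?J"
    by (rule nn_integral_column_average[where w = w'])
       (auto simp: S w' indicator_def B Bj)
  \<comment> \<open>Dividing the count by the number \<open>a\<close> of translates leaves the main
    term \<open>2 * \<rho>\<close> and the loss \<open>1 / a\<close>.\<close>
  also have "ennreal (2 * \<rho> * real a + 1) = of_nat a * ennreal (2 * \<rho> + 1 / real a)"
  proof -
    have "2 * \<rho> * real a + 1 = real a * (2 * \<rho> + 1 / real a)" using a by (simp add: field_simps)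
    then show ?thesis using \<rho> by (simp add: ennreal_of_nat_eq_real_of_nat ennreal_mult)
  qed
  finally have "of_nat a * ?I \<le> of_nat a * (?s * (ennreal (2 * \<rho> + 1 / real a) * ?J))"
    by (simp add: mult_ac)
  then show ?thesis
    using a by (subst (asm) ennreal_mult_le_mult_iff) auto
qed

section \<open>Measures of the approximation sets\<close>

text \<open>The radius is a free parameter, so the measure estimates do not refer to \<psi>; the set
  is not cut down to the cube, so it stays periodic.\<close>

definition approx_set :: "real ^ 'm::finite \<Rightarrow> real \<Rightarrow> int ^ 'n::finite \<Rightarrow> (real ^ 'm ^ 'n) set" where
  "approx_set y \<rho> q = {x. \<forall>j. rowmul q x $ j \<in> mod1_ball (y $ j) \<rho>}"

lemma approx_set_measurable [measurable]: "approx_set y \<rho> q \<in> sets borel"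
  unfolding approx_set_def by measurable

text \<open>Each \<open>P j\<close> depends on column \<open>j\<close> only, so an intersection over
  other columns is invariant under translations of column \<open>j\<close>, and \<open>step\<close>
  contributes one factor \<open>c\<close> per column. The relation \<open>R\<close> covers the exact
  measure of one set and the upper bound for overlaps at once.\<close>

lemma emeasure_column_product:
  fixes P :: "'m::finite \<Rightarrow> (real ^ 'm ^ 'n::finite) set"
  assumes P [measurable]: "\<And>j. P j \<in> sets borel"
    and per: "\<And>j x b. b \<in> Basis \<Longrightarrow> x + b \<in> P j \<longleftrightarrow> x \<in> P j"
    and col: "\<And>j j' x z w. j \<noteq> j' \<Longrightarrow> x + z *\<^sub>R column_vec j' w \<in> P j \<longleftrightarrow> x \<in> P j"
    and R: "R = (\<le>) \<or> R = (=)"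
    and step: "\<And>j B. B \<in> sets borel \<Longrightarrow> (\<And>x b. b \<in> Basis \<Longrightarrow> x + b \<in> B \<longleftrightarrow> x \<in> B) \<Longrightarrow>
        (\<And>x z w. x + z *\<^sub>R column_vec j w \<in> B \<longleftrightarrow> x \<in> B) \<Longrightarrow>
        R (emeasure lborel (P j \<inter> B \<inter> unit_cube)) (c * emeasure lborel (B \<inter> unit_cube))"
  shows "R (emeasure lborel ((\<Inter>j. P j) \<inter> unit_cube)) (c ^ CARD('m))"
proof -
  have "R (emeasure lborel ((\<Inter>j\<in>J. P j) \<inter> unit_cube)) (c ^ card J)" if "finite J" for J
    using that
  proof (induction J rule: finite_induct)
    case empty
    then show ?case using R by (auto simp: emeasure_unit_cube)
  next
    case (insert j J)
    have "R (emeasure lborel (P j \<inter> (\<Inter>j\<in>J. P j) \<inter> unit_cube))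
        (c * emeasure lborel ((\<Inter>j\<in>J. P j) \<inter> unit_cube))"
    proof (rule step)
      show "(\<Inter>j\<in>J. P j) \<in> sets borel"
      proof (cases "J = {}")
        case False
        then show ?thesis using insert.hyps by (intro sets.finite_INT) auto
      qed simp
      show "x + b \<in> (\<Inter>j\<in>J. P j) \<longleftrightarrow> x \<in> (\<Inter>j\<in>J. P j)" if "b \<in> Basis" for x b
        using per[OF that] by simp
      show "x + z *\<^sub>R column_vec j w \<in> (\<Inter>j\<in>J. P j) \<longleftrightarrow> x \<in> (\<Inter>j\<in>J. P j)" for x z w
      proof -
        have "x + z *\<^sub>R column_vec j w \<in> P l \<longleftrightarrow> x \<in> P l" if "l \<in> J" for l
          using insert.hyps that by (intro col) auto
        then show ?thesis by simp
      qed
    qed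
    then show ?case
      using R insert order_trans[OF _ mult_left_mono[OF _ zero_le, of _ _ c]]
      by (elim disjE) (simp_all add: mult_left_mono)
  qed
  from this[of UNIV] show ?thesis by simp
qed

lemma emeasure_Int_unit_cube:
  fixes P B :: "'a::euclidean_space set"
  assumes [measurable]: "P \<in> sets borel" "B \<in> sets borel"
  shows "emeasure lborel (P \<inter> B \<inter> unit_cube) = (\<integral>\<^sup>+x\<in>unit_cube. indicator P x * indicator B x \<partial>lborel)"
  by (simp flip: indicator_inter_arith)

lemma emeasure_approx_set:
  fixes q :: "int ^ 'n::finite" and y :: "real ^ 'm::finite"
  assumes q: "q \<noteq> 0" and \<rho>: "0 \<le> \<rho>" "\<rho> \<le> 1 / 2"
  shows "emeasure lborel (approx_set y \<rho> q \<inter> unit_cube) = ennreal ((2 * \<rho>) ^ CARD('m))"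
proof -
  define P :: "'m \<Rightarrow> (real ^ 'm ^ 'n) set" where
    "P j = {x. rowmul q x $ j \<in> mod1_ball (y $ j) \<rho>}" for j
  have [measurable]: "P j \<in> sets borel" for j unfolding P_def by measurable
  obtain w :: "real ^ 'n" where w: "(\<Sum>l\<in>UNIV. of_int (q $ l) * w $ l) = 1"
    using obtain_dual_vec[OF q] .
  have "emeasure lborel ((\<Inter>j. P j) \<inter> unit_cube) = ennreal (2 * \<rho>) ^ CARD('m)"
  proof (rule emeasure_column_product)
    fix j and B :: "(real ^ 'm ^ 'n) set"
    assume [measurable]: "B \<in> sets borel" and B: "\<And>x b. b \<in> Basis \<Longrightarrow> x + b \<in> B \<longleftrightarrow> x \<in> B"
        "\<And>x z w. x + z *\<^sub>R column_vec j w \<in> B \<longleftrightarrow> x \<in> B"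
    have "emeasure lborel (P j \<inter> B \<inter> unit_cube)
      = (\<integral>\<^sup>+x\<in>unit_cube. indicator (mod1_ball (y $ j) \<rho>) (rowmul q x $ j) * indicator B x \<partial>lborel)"
      by (subst emeasure_Int_unit_cube) (auto simp: P_def indicator_def)
    also have "\<dots> = emeasure lborel (mod1_ball (y $ j) \<rho> \<inter> {0..<1}) *
        (\<integral>\<^sup>+x\<in>unit_cube. indicator B x \<partial>lborel)"
      by (rule nn_integral_column_average[OF _ _ mod1_ball_add_of_int _ _ w])
         (auto simp: B indicator_def)
    finally show "emeasure lborel (P j \<inter> B \<inter> unit_cube) = ennreal (2 * \<rho>) * emeasure lborel (B \<inter> unit_cube)"
      by (simp add: emeasure_mod1_ball[OF \<rho>] flip: indicator_inter_arith)
  qed (auto simp: P_def rowmul_add_Basis_mem[OF _ mod1_ball_add_of_int] rowmul_add_column)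
  also have "(\<Inter>j. P j) = approx_set y \<rho> q" by (auto simp: P_def approx_set_def)
  finally show ?thesis using \<rho> by (simp add: ennreal_power)
qed

text \<open>The loss \<open>\<kappa>\<close> is what dependence of \<open>q\<close> and
  \<open>r\<close> costs in every column: none for independent vectors, \<open>1 / a\<close> for
  parallel ones. The bound is not symmetric, since \<open>a\<close> is the multiplier of
  \<open>q\<close>; it will be applied with \<open>q\<close> the longer vector, which makes the loss
  smallest.\<close>

lemma emeasure_approx_set_overlap:
  fixes q r :: "int ^ 'n::finite" and y :: "real ^ 'm::finite"
  assumes r: "r \<noteq> 0" and \<rho>: "0 \<le> \<rho>" "\<rho> \<le> 1 / 2" and \<rho>': "0 \<le> \<rho>'" "\<rho>' \<le> 1 / 2"
    and dep: "(\<exists>i k. q $ i * r $ k \<noteq> q $ k * r $ i) \<and> \<kappa> = 0 \<or>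
      (\<exists>a b u. u \<noteq> 0 \<and> a > 0 \<and> coprime (int a) b \<and> q = int a *s u \<and> r = b *s u \<and> \<kappa> = 1 / real a)"
  shows "emeasure lborel (approx_set y \<rho> q \<inter> approx_set y \<rho>' r \<inter> unit_cube)
    \<le> ennreal ((2 * \<rho> * (2 * \<rho>' + \<kappa>)) ^ CARD('m))"
proof -
  have \<kappa>: "\<kappa> \<ge> 0" using dep by auto
  define P :: "'m \<Rightarrow> (real ^ 'm ^ 'n) set" where
    "P j = {x. rowmul q x $ j \<in> mod1_ball (y $ j) \<rho> \<and> rowmul r x $ j \<in> mod1_ball (y $ j) \<rho>'}" for j
  have [measurable]: "P j \<in> sets borel" for j unfolding P_def by measurable
  have "emeasure lborel ((\<Inter>j. P j) \<inter> unit_cube) \<le> ennreal (2 * \<rho> * (2 * \<rho>' + \<kappa>)) ^ CARD('m)"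
  proof (rule emeasure_column_product)
    fix j and B :: "(real ^ 'm ^ 'n) set"
    assume [measurable]: "B \<in> sets borel" and B: "\<And>x b. b \<in> Basis \<Longrightarrow> x + b \<in> B \<longleftrightarrow> x \<in> B"
        "\<And>x z w. x + z *\<^sub>R column_vec j w \<in> B \<longleftrightarrow> x \<in> B"
    let ?S = "mod1_ball (y $ j) \<rho>" and ?T = "mod1_ball (y $ j) \<rho>'"
    let ?J = "(\<integral>\<^sup>+x\<in>unit_cube. indicator B x \<partial>lborel) :: ennreal"
    have "emeasure lborel (P j \<inter> B \<inter> unit_cube) = (\<integral>\<^sup>+x\<in>unit_cube.
        indicator ?S (rowmul q x $ j) * (indicator ?T (rowmul r x $ j) * indicator B x) \<partial>lborel)"
      by (subst emeasure_Int_unit_cube) (auto simp: P_def indicator_def intro!: nn_integral_cong)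
    also have "\<dots> \<le> emeasure lborel (?S \<inter> {0..<1}) * (ennreal (2 * \<rho>' + \<kappa>) * ?J)"
      using dep
    proof (elim disjE conjE exE)
      fix i k assume ik: "q $ i * r $ k \<noteq> q $ k * r $ i" and "\<kappa> = 0"
      then show ?thesis
        using nn_integral_overlap_independent[OF _ _ _ mod1_ball_add_of_int mod1_ball_add_of_int _ _ r ik, where B = B and j = j]
        by (simp add: B emeasure_mod1_ball[OF \<rho>'])
    next
      fix a b u assume "u \<noteq> 0" "a > 0" "coprime (int a) b" "q = int a *s u" "r = b *s u" "\<kappa> = 1 / real a"
      then show ?thesis
        using nn_integral_overlap_parallel[OF _ _ mod1_ball_add_of_int, where B = B and j = j and u = u and a = a and b = b and \<rho> = \<rho>' and q = q and r = r] \<rho>'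
        by (simp add: B)
    qed
    also have "\<dots> = ennreal (2 * \<rho> * (2 * \<rho>' + \<kappa>)) * emeasure lborel (B \<inter> unit_cube)"
      using \<rho> \<rho>' \<kappa>
      by (simp add: emeasure_mod1_ball[OF \<rho>] ennreal_mult mult.assoc flip: indicator_inter_arith)
    finally show "emeasure lborel (P j \<inter> B \<inter> unit_cube)
        \<le> ennreal (2 * \<rho> * (2 * \<rho>' + \<kappa>)) * emeasure lborel (B \<inter> unit_cube)" .
  qed (auto simp: P_def rowmul_add_Basis_mem[OF _ mod1_ball_add_of_int] rowmul_add_column)
  also have "(\<Inter>j. P j) = approx_set y \<rho> q \<inter> approx_set y \<rho>' r" by (auto simp: P_def approx_set_def)
  finally show ?thesis using \<rho> \<rho>' \<kappa> by (simp add: ennreal_power)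
qed

text \<open>If all minors vanish, choose \<open>i\<close> with \<open>q $ i\<close> nonzero and
  reduce the pair \<open>q $ i\<close>, \<open>r $ i\<close> to coprime \<open>a\<close>,
  \<open>b\<close>. Then \<open>a * r $ k = b * q $ k\<close> for all \<open>k\<close>, so
  \<open>a\<close> divides every \<open>q $ k\<close>, and \<open>u\<close> is the integral
  quotient.\<close>

lemma int_vec_dependence_cases:
  fixes q r :: "int ^ 'n::finite"
  assumes q: "q \<noteq> 0"
  obtains i k where "q $ i * r $ k \<noteq> q $ k * r $ i"
  | a b u where "u \<noteq> 0" "a > 0" "coprime (int a) b" "q = int a *s u" "r = b *s u"
proof (cases "\<exists>i k. q $ i * r $ k \<noteq> q $ k * r $ i")
  case False
  then have eq: "q $ i * r $ k = q $ k * r $ i" for i k by blast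
  obtain i where i: "q $ i \<noteq> 0" using q by (auto simp: vec_eq_iff)
  \<comment> \<open>The gcd carries the sign of \<open>q $ i\<close>, which makes \<open>a\<close>
    positive.\<close>
  define g where "g = sgn (q $ i) * gcd (q $ i) (r $ i)"
  have g0: "g \<noteq> 0" and gq: "g dvd q $ i" and gr: "g dvd r $ i"
    using i by (auto simp: g_def sgn_if)
  define a b where "a = q $ i div g" and "b = r $ i div g"
  have qi: "q $ i = a * g" and ri: "r $ i = b * g" using gq gr by (auto simp: a_def b_def)
  have "a > 0"
  proof -
    have "a * \<bar>g\<bar> = \<bar>q $ i\<bar>" using qi i by (auto simp: g_def sgn_if split: if_splits)
    then show ?thesis using i by (metis abs_ge_zero linorder_not_less mult_nonpos_nonneg zero_less_abs_iff)
  qed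
  have cop: "coprime a b"
  proof -
    have "gcd (q $ i) (r $ i) = gcd a b * \<bar>g\<bar>"
      unfolding qi ri by (metis gcd_mult_distrib_int abs_abs gcd.commute mult.commute abs_mult gcd_mult_left normalize_int_def)
    moreover have "\<bar>g\<bar> = gcd (q $ i) (r $ i)" using i by (auto simp: g_def abs_mult)
    ultimately have "gcd a b * \<bar>g\<bar> = 1 * \<bar>g\<bar>" by simp
    then show ?thesis using g0 by (simp add: coprime_iff_gcd_eq_1)
  qed
  have ab: "a * r $ k = b * q $ k" for k
  proof -
    have "g * (a * r $ k) = g * (b * q $ k)" using eq[of i k] unfolding qi ri by (simp add: mult_ac)
    then show ?thesis using g0 by simp
  qed
  have "a dvd q $ k" for k
  proof -
    have "a dvd b * q $ k" by (metis ab dvd_triv_left)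
    then show ?thesis using cop by (simp add: coprime_dvd_mult_right_iff)
  qed
  define u where "u = (\<chi> k. q $ k div a)"
  have qu: "q $ k = a * u $ k" for k using \<open>a dvd q $ k\<close> by (simp add: u_def)
  have "a * r $ k = a * (b * u $ k)" for k using ab[of k] qu[of k] by (simp add: mult_ac)
  then have ru: "r $ k = b * u $ k" for k using \<open>a > 0\<close> by simp
  have "u \<noteq> 0" using i qu[of i] by auto
  moreover have "nat a > 0" "coprime (int (nat a)) b" "q = int (nat a) *s u" "r = b *s u"
    using \<open>a > 0\<close> cop qu ru by (auto simp: vec_eq_iff)
  ultimately show ?thesis using that(2) by blast
qed (use that(1) in blast)

section \<open>Counting integer vectors\<close>

lemma supnorm_int_le_iff: "supnorm_int q \<le> k \<longleftrightarrow> (\<forall>i. \<bar>q $ i\<bar> \<le> int k)"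
  by (simp add: supnorm_int_def nat_le_iff Max_le_iff image_subset_iff)

lemma supnorm_int_eq_0_iff [simp]: "supnorm_int q = 0 \<longleftrightarrow> q = 0"
  using supnorm_int_le_iff[of q 0] by (auto simp: vec_eq_iff)

lemma supnorm_int_zero [simp]: "supnorm_int 0 = 0"
  by simp

lemma supnorm_int_smult: "supnorm_int (c *s q) = nat \<bar>c\<bar> * supnorm_int q"
proof -
  have ge: "0 \<le> Max (range (\<lambda>i. \<bar>q $ i\<bar>))"
    by (rule order_trans[OF abs_ge_zero Max_ge]) auto
  have "Max (range (\<lambda>i. \<bar>c * q $ i\<bar>)) = Max ((\<lambda>x. \<bar>c\<bar> * x) ` range (\<lambda>i. \<bar>q $ i\<bar>))"
    by (simp add: image_image abs_mult)
  also have "\<dots> = \<bar>c\<bar> * Max (range (\<lambda>i. \<bar>q $ i\<bar>))"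
    by (rule mono_Max_commute[symmetric]) (auto intro!: monoI mult_left_mono)
  finally show ?thesis using ge by (simp add: supnorm_int_def nat_mult_distrib)
qed

lemma card_vec_box:
  fixes F :: "'n::finite \<Rightarrow> 'a set"
  shows "card {u :: 'a ^ 'n. \<forall>i. u $ i \<in> F i} = (\<Prod>i\<in>UNIV. card (F i))"
    and "(\<And>i. finite (F i)) \<Longrightarrow> finite {u :: 'a ^ 'n. \<forall>i. u $ i \<in> F i}"
proof -
  have eq: "{u :: 'a ^ 'n. \<forall>i. u $ i \<in> F i} = vec_lambda ` (\<Pi>\<^sub>E i\<in>UNIV. F i)"
  proof (intro equalityI subsetI)
    fix u assume "u \<in> {u :: 'a ^ 'n. \<forall>i. u $ i \<in> F i}"
    then have "vec_nth u \<in> (\<Pi>\<^sub>E i\<in>UNIV. F i)" "u = vec_lambda (vec_nth u)" by auto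
    then show "u \<in> vec_lambda ` (\<Pi>\<^sub>E i\<in>UNIV. F i)" by blast
  qed auto
  have inj: "inj_on vec_lambda (\<Pi>\<^sub>E i\<in>UNIV. F i)" by (auto intro!: inj_onI simp: vec_lambda_inject)
  show "card {u :: 'a ^ 'n. \<forall>i. u $ i \<in> F i} = (\<Prod>i\<in>UNIV. card (F i))"
    unfolding eq by (simp add: card_image[OF inj] card_PiE)
  show "finite {u :: 'a ^ 'n. \<forall>i. u $ i \<in> F i}" if "\<And>i. finite (F i)"
    unfolding eq using that by (intro finite_imageI finite_PiE) auto
qed

lemma supnorm_int_ball_eq:
  "{q :: int ^ 'n::finite. supnorm_int q \<le> k} = {q. \<forall>i. q $ i \<in> {- int k..int k}}"
  by (auto simp: supnorm_int_le_iff abs_le_iff) (metis minus_le_iff)+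

lemma finite_supnorm_int_ball [simp]: "finite {q :: int ^ 'n::finite. supnorm_int q \<le> k}"
  unfolding supnorm_int_ball_eq by (rule card_vec_box) auto

lemma card_supnorm_int_ball: "card {q :: int ^ 'n::finite. supnorm_int q \<le> k} = (2 * k + 1) ^ CARD('n)"
proof -
  have "card {- int k..int k} = 2 * k + 1" unfolding card_atLeastAtMost_int by linarith
  then show ?thesis unfolding supnorm_int_ball_eq by (subst card_vec_box(1)) (simp only: prod_constant)
qed

lemma finite_supnorm_int_sphere [simp]: "finite {q :: int ^ 'n::finite. supnorm_int q = k}"
  by (rule finite_subset[OF _ finite_supnorm_int_ball[of k]]) auto

text \<open>The sphere is the difference of two cubes, of cardinality
  \<open>?x ^ n - ?y ^ n\<close>, which factors as 2 times a sum of \<open>n\<close> products. The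
  product with \<open>i = n - 1\<close> alone gives the lower bound; replacing \<open>?y\<close> by
  \<open>?x\<close> and using \<open>?x \<le> 3 * k\<close> gives the upper one.\<close>

lemma card_supnorm_int_sphere:
  assumes "k > 0"
  shows "real k ^ (CARD('n) - 1) \<le> real (card {q :: int ^ 'n::finite. supnorm_int q = k})"
    and "real (card {q :: int ^ 'n. supnorm_int q = k})
      \<le> 2 * real CARD('n) * 3 ^ (CARD('n) - 1) * real k ^ (CARD('n) - 1)"
proof -
  let ?n = "CARD('n)" and ?x = "2 * real k + 1" and ?y = "2 * real k - 1"
  have n: "?n > 0" by simp
  have "{q :: int ^ 'n. supnorm_int q = k} = {q. supnorm_int q \<le> k} - {q. supnorm_int q \<le> k - 1}"
    using assms by auto
  moreover have "card ({q :: int ^ 'n. supnorm_int q \<le> k} - {q. supnorm_int q \<le> k - 1})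
      = card {q :: int ^ 'n. supnorm_int q \<le> k} - card {q :: int ^ 'n. supnorm_int q \<le> k - 1}"
    by (rule card_Diff_subset) auto
  ultimately have "card {q :: int ^ 'n. supnorm_int q = k} = (2 * k + 1) ^ ?n - (2 * (k - 1) + 1) ^ ?n"
    unfolding card_supnorm_int_ball by simp
  moreover have "(2 * (k - 1) + 1) ^ ?n \<le> (2 * k + 1) ^ ?n" by (intro power_mono) auto
  moreover have "real (2 * (k - 1) + 1) = ?y" using assms by simp
  moreover have "real (2 * k + 1) = ?x" by simp
  ultimately have "real (card {q :: int ^ 'n. supnorm_int q = k}) = ?x ^ ?n - ?y ^ ?n"
    by (simp only: of_nat_diff of_nat_power)
  also have "\<dots> = 2 * (\<Sum>i<?n. ?x ^ i * ?y ^ (?n - Suc i))"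
    by (subst power_diff_sumr2) (simp add: mult.commute)
  finally have card: "real (card {q :: int ^ 'n. supnorm_int q = k})
      = 2 * (\<Sum>i<?n. ?x ^ i * ?y ^ (?n - Suc i))" .
  have y: "?y \<ge> 0" using assms by simp
  have "real k ^ (?n - 1) \<le> ?x ^ (?n - 1) * ?y ^ (?n - Suc (?n - 1))"
    using n by (simp add: power_mono)
  also have "\<dots> \<le> (\<Sum>i<?n. ?x ^ i * ?y ^ (?n - Suc i))"
    using y n by (intro member_le_sum) (auto intro!: mult_nonneg_nonneg zero_le_power)
  also have "\<dots> \<le> 2 * (\<Sum>i<?n. ?x ^ i * ?y ^ (?n - Suc i))"
    using y by (simp add: sum_nonneg)
  finally show "real k ^ (?n - 1) \<le> real (card {q :: int ^ 'n. supnorm_int q = k})"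
    unfolding card .
  have "(\<Sum>i<?n. ?x ^ i * ?y ^ (?n - Suc i)) \<le> (\<Sum>i<?n. ?x ^ (?n - 1))"
  proof (rule sum_mono)
    fix i assume i: "i \<in> {..<?n}"
    have "?x ^ i * ?y ^ (?n - Suc i) \<le> ?x ^ i * ?x ^ (?n - Suc i)"
      using y by (intro mult_left_mono power_mono) auto
    also have "\<dots> = ?x ^ (?n - 1)" using i by (simp flip: power_add)
    finally show "?x ^ i * ?y ^ (?n - Suc i) \<le> ?x ^ (?n - 1)" .
  qed
  also have "\<dots> = real ?n * ?x ^ (?n - 1)" by simp
  also have "?x ^ (?n - 1) \<le> (3 * real k) ^ (?n - 1)"
    using assms by (intro power_mono) auto
  finally show "real (card {q :: int ^ 'n. supnorm_int q = k}) \<le> 2 * real ?n * 3 ^ (?n - 1) * real k ^ (?n - 1)"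
    unfolding card by (simp add: power_mult_distrib mult_ac)
qed

section \<open>Total overlap error of parallel pairs\<close>

text \<open>At most one summand below is the overlap error of the pair \<open>(q, r)\<close>, namely the one where
  \<open>a\<close> and \<open>b\<close> are coprime; summing over all \<open>a\<close> avoids having to choose it.\<close>

definition parallel_weight :: "nat \<Rightarrow> int ^ 'n::finite \<Rightarrow> int ^ 'n \<Rightarrow> real" where
  "parallel_weight m q r = (\<Sum>a\<in>{1..supnorm_int q}.
     if \<exists>u b. q = int a *s u \<and> r = b *s u \<and> 0 < \<bar>b\<bar> \<and> \<bar>b\<bar> \<le> int a then 1 / real a ^ m else 0)"

lemma parallel_weight_nonneg: "parallel_weight m q r \<ge> 0"
  by (auto simp: parallel_weight_def intro!: sum_nonneg)

text \<open>The comparison of norms turns into \<open>\<bar>b\<bar> \<le> int a\<close>, so this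
  \<open>a\<close> satisfies the condition of one summand, and all summands are nonnegative.\<close>

lemma parallel_weight_ge:
  assumes u: "u \<noteq> 0" and a: "a > 0" and q: "q = int a *s u" and r: "r = b *s u" and "r \<noteq> 0"
    and le: "supnorm_int r \<le> supnorm_int q"
  shows "1 / real a ^ m \<le> parallel_weight m q r"
proof -
  have u0: "supnorm_int u > 0" using u by (simp add: neq0_conv[symmetric])
  have b: "b \<noteq> 0" using assms(5) by (auto simp: r vec_eq_iff)
  have "nat \<bar>b\<bar> \<le> a" using le u0 by (simp add: q r supnorm_int_smult)
  then have "\<bar>b\<bar> \<le> int a" by linarith
  then have cond: "\<exists>u b. q = int a *s u \<and> r = b *s u \<and> 0 < \<bar>b\<bar> \<and> \<bar>b\<bar> \<le> int a"
    using q r b by auto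
  have "a \<in> {1..supnorm_int q}" using a u0 by (simp add: q supnorm_int_smult)
  then have "(if \<exists>u b. q = int a *s u \<and> r = b *s u \<and> 0 < \<bar>b\<bar> \<and> \<bar>b\<bar> \<le> int a then 1 / real a ^ m else 0)
      \<le> parallel_weight m q r"
    unfolding parallel_weight_def by (rule member_le_sum) auto
  with cond show ?thesis by simp
qed

text \<open>After exchanging the sums, fix \<open>a\<close>. If \<open>a\<close> divides
  \<open>q\<close>, the quotient \<open>u\<close> is unique and \<open>r\<close> is one of at most
  \<open>2 * a\<close> multiples \<open>b *s u\<close>, each of weight
  \<open>1 / a ^ m\<close>.\<close>

lemma sum_parallel_weight_le:
  assumes "finite R" "m > 0"
  shows "(\<Sum>r\<in>R. parallel_weight m q r)
    \<le> (\<Sum>a\<in>{1..supnorm_int q}. if \<exists>u. q = int a *s u then 2 / real a ^ (m - 1) else 0)"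
proof -
  let ?P = "\<lambda>a r. \<exists>u b. q = int a *s u \<and> r = b *s u \<and> 0 < \<bar>b\<bar> \<and> \<bar>b\<bar> \<le> int a"
  have "(\<Sum>r\<in>R. parallel_weight m q r)
      = (\<Sum>a\<in>{1..supnorm_int q}. \<Sum>r\<in>R. if ?P a r then 1 / real a ^ m else 0)"
    unfolding parallel_weight_def by (rule sum.swap)
  also have "\<dots> \<le> (\<Sum>a\<in>{1..supnorm_int q}. if \<exists>u. q = int a *s u then 2 / real a ^ (m - 1) else 0)"
  proof (rule sum_mono)
    fix a assume a: "a \<in> {1..supnorm_int q}"
    show "(\<Sum>r\<in>R. if ?P a r then 1 / real a ^ m else 0)
      \<le> (if \<exists>u. q = int a *s u then 2 / real a ^ (m - 1) else 0)"
    proof (cases "\<exists>u. q = int a *s u")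
      case True
      then obtain u where u: "q = int a *s u" by blast
      have uniq: "u' = u" if "q = int a *s u'" for u'
        using that u a by (auto simp: vec_eq_iff)
      let ?B = "{b. 0 < \<bar>b\<bar> \<and> \<bar>b\<bar> \<le> int a}"
      have B: "?B = {- int a..int a} - {0}" by auto
      have cardB: "card ?B = 2 * a" unfolding B by (subst card_Diff_singleton) auto
      have finB: "finite ?B" unfolding B by simp
      have "{r \<in> R. ?P a r} \<subseteq> (\<lambda>b. b *s u) ` ?B" using uniq by blast
      then have "card {r \<in> R. ?P a r} \<le> card ?B"
        using finB by (meson card_image_le card_mono finite_imageI order_trans)
      then have "card {r \<in> R. ?P a r} \<le> 2 * a" using cardB by simp
      moreover have "(\<Sum>r\<in>R. if ?P a r then 1 / real a ^ m else 0) = real (card {r \<in> R. ?P a r}) * (1 / real a ^ m)"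
        using assms by (simp add: sum.If_cases Int_def)
      ultimately have "(\<Sum>r\<in>R. if ?P a r then 1 / real a ^ m else 0) \<le> real (2 * a) * (1 / real a ^ m)"
        by (simp only: of_nat_le_iff mult_right_mono zero_le_divide_1_iff of_nat_0_le_iff zero_le_power)
      also have "\<dots> = 2 / real a ^ (m - 1)"
        using a \<open>m > 0\<close> by (cases m) (auto simp: field_simps)
      finally show ?thesis using True by simp
    next
      case False
      then have "(if ?P a r then 1 / real a ^ m else 0) = 0" for r by auto
      then have "(\<Sum>r\<in>R. if ?P a r then 1 / real a ^ m else 0) = 0" by (intro sum.neutral ballI)
      then show ?thesis using False by simp
    qed
  qed
  finally show ?thesis .
qed

text \<open>Such vectors are \<open>a\<close> times vectors of norm \<open>s / a\<close>; there are
  none unless \<open>a\<close> divides \<open>s\<close>.\<close>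

lemma card_divisible_sphere:
  assumes "s > 0" "a > 0"
  shows "real (card {q :: int ^ 'n::finite. supnorm_int q = s \<and> (\<exists>u. q = int a *s u)})
      \<le> 2 * real CARD('n) * 3 ^ (CARD('n) - 1) * real s ^ (CARD('n) - 1) / real a ^ (CARD('n) - 1)"
proof (cases "a dvd s")
  case True
  then obtain k where k: "s = a * k" by (elim dvdE)
  have "k > 0" using assms k by simp
  have "{q :: int ^ 'n. supnorm_int q = s \<and> (\<exists>u. q = int a *s u)} \<subseteq> (\<lambda>u. int a *s u) ` {u. supnorm_int u = k}"
    using assms by (auto simp: k supnorm_int_smult)
  then have "card {q :: int ^ 'n. supnorm_int q = s \<and> (\<exists>u. q = int a *s u)} \<le> card {u :: int ^ 'n. supnorm_int u = k}"
    by (rule surj_card_le[OF finite_supnorm_int_sphere])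
  also have "real \<dots> \<le> 2 * real CARD('n) * 3 ^ (CARD('n) - 1) * real k ^ (CARD('n) - 1)"
    by (rule card_supnorm_int_sphere) fact
  also have "real k ^ (CARD('n) - 1) = real s ^ (CARD('n) - 1) / real a ^ (CARD('n) - 1)"
    using assms by (simp add: k power_mult_distrib)
  finally show ?thesis by simp
next
  case False
  then have "{q :: int ^ 'n. supnorm_int q = s \<and> (\<exists>u. q = int a *s u)} = {}"
    by (auto simp: supnorm_int_smult)
  then show ?thesis by (simp only: card.empty) simp
qed

text \<open>Telescoping with 1/a^2 \<le> 1/(a-1) - 1/a; the induction runs on the sharper bound that
  keeps the last term.\<close>

lemma sum_inverse_squares_le: "(\<Sum>a\<in>{1..N}. 1 / real a ^ 2) \<le> 2"
proof -
  have le: "(\<Sum>a\<in>{1..Suc N}. 1 / real a ^ 2) \<le> 2 - 1 / real (Suc N)" for N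
  proof (induction N)
    case (Suc N)
    have "1 / (real N + 2) ^ 2 \<le> 1 / (real N + 1) - 1 / (real N + 2)"
      by (simp add: divide_simps power2_eq_square)
    then show ?case using Suc by (simp add: add_ac)
  qed simp
  have "(\<Sum>a\<in>{1..N}. 1 / real a ^ 2) \<le> (\<Sum>a\<in>{1..Suc N}. 1 / real a ^ 2)" by simp
  also have "\<dots> \<le> 2 - 1 / real (Suc N)" by (rule le)
  also have "\<dots> \<le> 2" by simp
  finally show ?thesis .
qed

text \<open>Here the hypothesis \<open>n + m \<ge> 4\<close> enters: the error terms are governed by the series
  of \<open>a ^ (2 - n - m)\<close>.\<close>

lemma sum_sphere_parallel_weight_le:
  assumes "s > 0" "m > 0" "CARD('n::finite) + m \<ge> 4" "finite R"
  shows "(\<Sum>q | supnorm_int q = s. \<Sum>r\<in>R. parallel_weight m (q :: int ^ 'n) r)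
    \<le> 8 * real CARD('n) * 3 ^ (CARD('n) - 1) * real s ^ (CARD('n) - 1)"
proof -
  let ?n = "CARD('n)"
  let ?K = "2 * real ?n * 3 ^ (?n - 1) * real s ^ (?n - 1)"
  let ?Q = "\<lambda>a. {q :: int ^ 'n. supnorm_int q = s \<and> (\<exists>u. q = int a *s u)}"
  have "(\<Sum>q | supnorm_int q = s. \<Sum>r\<in>R. parallel_weight m (q :: int ^ 'n) r)
    \<le> (\<Sum>q | supnorm_int (q :: int ^ 'n) = s. \<Sum>a\<in>{1..s}. if \<exists>u. q = int a *s u then 2 / real a ^ (m - 1) else 0)"
    by (rule sum_mono) (use sum_parallel_weight_le[OF \<open>finite R\<close> \<open>m > 0\<close>] in auto)
  also have "\<dots> = (\<Sum>a\<in>{1..s}. \<Sum>q | supnorm_int (q :: int ^ 'n) = s. if \<exists>u. q = int a *s u then 2 / real a ^ (m - 1) else 0)"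
    by (rule sum.swap)
  also have "\<dots> = (\<Sum>a\<in>{1..s}. real (card (?Q a)) * (2 / real a ^ (m - 1)))"
    by (simp add: sum.If_cases Int_def)
  also have "\<dots> \<le> (\<Sum>a\<in>{1..s}. 2 * ?K * (1 / real a ^ 2))"
  proof (rule sum_mono)
    fix a assume a: "a \<in> {1..s}"
    then have a1: "real a \<ge> 1" by simp
    have "real (card (?Q a)) * (2 / real a ^ (m - 1)) \<le> ?K / real a ^ (?n - 1) * (2 / real a ^ (m - 1))"
      using card_divisible_sphere[where 'n = 'n, of s a] a \<open>s > 0\<close> by (intro mult_right_mono) auto
    also have "\<dots> = 2 * ?K * (1 / real a ^ ((?n - 1) + (m - 1)))"
      by (simp only: power_add) (simp add: mult_ac)
    also have "\<dots> \<le> 2 * ?K * (1 / real a ^ 2)"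
    proof -
      \<comment> \<open>The exponent is n + m - 2, which is at least 2 by the assumption on the
        dimensions.\<close>
      have "real a ^ 2 \<le> real a ^ ((?n - 1) + (m - 1))"
        using assms a1 by (intro power_increasing) auto
      then show ?thesis using a1 by (intro mult_left_mono divide_left_mono) auto
    qed
    finally show "real (card (?Q a)) * (2 / real a ^ (m - 1)) \<le> 2 * ?K * (1 / real a ^ 2)" .
  qed
  also have "\<dots> = 2 * ?K * (\<Sum>a\<in>{1..s}. 1 / real a ^ 2)" by (simp only: sum_distrib_left)
  also have "\<dots> \<le> 2 * ?K * 2" by (intro mult_left_mono sum_inverse_squares_le) auto
  finally show ?thesis by (simp add: mult_ac)
qed

section \<open>The second moment method\<close>

text \<open>Take \<open>d\<close> with \<open>(1 + d) ^ m < 1 + \<epsilon>\<close>. Either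
  \<open>y \<le> d * x\<close> and \<open>y\<close> is absorbed into the first term, or
  \<open>x < y / d\<close> and the second term alone suffices. This keeps the constant of the main
  term arbitrarily close to 1.\<close>

lemma power_add_le_eps:
  fixes \<epsilon> :: real
  assumes "\<epsilon> > 0"
  obtains C where "C \<ge> 0" "\<And>x y :: real. 0 \<le> x \<Longrightarrow> 0 \<le> y \<Longrightarrow> (x + y) ^ m \<le> (1 + \<epsilon>) * x ^ m + C * y ^ m"
proof -
  have "((\<lambda>d::real. (1 + d) ^ m) \<longlongrightarrow> (1 + 0) ^ m) (at_right 0)" by (intro tendsto_intros)
  then have "\<forall>\<^sub>F d in at_right 0. (1 + d :: real) ^ m < 1 + \<epsilon>"
    by (rule order_tendstoD) (use assms in simp)
  moreover have "\<forall>\<^sub>F d in at_right 0. (0::real) < d" by (rule eventually_at_right_less)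
  ultimately have "\<forall>\<^sub>F d in at_right 0. (0::real) < d \<and> (1 + d) ^ m < 1 + \<epsilon>" by eventually_elim auto
  then obtain d :: real where d: "d > 0" "(1 + d) ^ m < 1 + \<epsilon>"
    using eventually_happens trivial_limit_at_right_real by (metis (no_types, lifting))
  show ?thesis
  proof (rule that)
    show "0 \<le> (1 / d + 1) ^ m" using d by simp
    fix x y :: real assume xy: "0 \<le> x" "0 \<le> y"
    show "(x + y) ^ m \<le> (1 + \<epsilon>) * x ^ m + (1 / d + 1) ^ m * y ^ m"
    proof (cases "y \<le> d * x")
      case True
      have "(x + y) ^ m \<le> ((1 + d) * x) ^ m"
        using True xy by (intro power_mono) (auto simp: algebra_simps)
      also have "\<dots> = (1 + d) ^ m * x ^ m" by (rule power_mult_distrib)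
      also have "\<dots> \<le> (1 + \<epsilon>) * x ^ m" using d xy by (intro mult_right_mono) auto
      also have "\<dots> \<le> (1 + \<epsilon>) * x ^ m + (1 / d + 1) ^ m * y ^ m" using d xy by simp
      finally show ?thesis .
    next
      case False
      then have "x \<le> y / d" using d by (simp add: field_simps)
      then have "(x + y) ^ m \<le> ((1 / d + 1) * y) ^ m"
        using xy by (intro power_mono) (auto simp: algebra_simps)
      also have "\<dots> = (1 / d + 1) ^ m * y ^ m" by (rule power_mult_distrib)
      also have "\<dots> \<le> (1 + \<epsilon>) * x ^ m + (1 / d + 1) ^ m * y ^ m" using assms xy by simp
      finally show ?thesis .
    qed
  qed
qed

text \<open>The counting variable \<open>S N\<close> has mean \<open>E N\<close> and, for large
  \<open>N\<close>, variance at most \<open>2 * \<epsilon> * E N ^ 2\<close>; Chebyshev then bounds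
  the probability that it is below half its mean by \<open>8 * \<epsilon>\<close>. Full probability,
  rather than just positive probability, results because \<epsilon> is arbitrary.\<close>

lemma (in prob_space) AE_infinitely_often_of_second_moment:
  fixes A :: "'i \<Rightarrow> 'a set" and Q :: "nat \<Rightarrow> 'i set"
  defines "E \<equiv> \<lambda>N. \<Sum>q\<in>Q N. prob (A q)"
  assumes A [measurable]: "\<And>q. A q \<in> events"
    and Q: "\<And>N. finite (Q N)"
    and E: "filterlim E at_top sequentially"
    and second: "\<And>\<epsilon>. \<epsilon> > 0 \<Longrightarrow> \<exists>C. \<forall>N. (\<Sum>q\<in>Q N. \<Sum>r\<in>Q N. prob (A q \<inter> A r)) \<le> (1 + \<epsilon>) * E N ^ 2 + C * E N"
  shows "AE x in M. infinite {q \<in> (\<Union>N. Q N). x \<in> A q}"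
proof -
  define S where "S N x = (\<Sum>q\<in>Q N. indicator (A q) x :: real)" for N x
  have [measurable]: "S N \<in> borel_measurable M" for N unfolding S_def by measurable
  have int: "integrable M (\<lambda>x. indicator D x :: real)" if "D \<in> events" for D
    using that by (intro integrable_real_indicator) (auto simp: less_top[symmetric])
  have expS: "expectation (S N) = E N" for N
    unfolding S_def E_def by (subst Bochner_Integration.integral_sum) (auto intro: int)
  have SS: "S N x ^ 2 = (\<Sum>q\<in>Q N. \<Sum>r\<in>Q N. indicator (A q \<inter> A r) x)" for N x
    by (simp add: S_def power2_eq_square sum_product indicator_inter_arith)
  have int2: "integrable M (\<lambda>x. S N x ^ 2)" for N unfolding SS by (intro Bochner_Integration.integrable_sum int) measurable
  have expSS: "expectation (\<lambda>x. S N x ^ 2) = (\<Sum>q\<in>Q N. \<Sum>r\<in>Q N. prob (A q \<inter> A r))" for N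
    unfolding SS by (simp add: Bochner_Integration.integral_sum Bochner_Integration.integrable_sum int)
  have int1: "integrable M (S N)" for N
    unfolding S_def by (intro Bochner_Integration.integrable_sum int) measurable
  \<comment> \<open>A point lying in only finitely many of the sets belongs to \<open>B K\<close>
    with \<open>K\<close> their number, so it suffices that every \<open>B K\<close> is
    null.\<close>
  define B where "B K = {x \<in> space M. \<forall>N. S N x \<le> real K}" for K
  have [measurable]: "B K \<in> events" for K unfolding B_def by measurable
  have B0: "prob (B K) = 0" for K
  proof -
    have "prob (B K) \<le> 8 * \<epsilon>" if \<epsilon>: "\<epsilon> > 0" for \<epsilon>
    proof -
      obtain C where C: "\<And>N. (\<Sum>q\<in>Q N. \<Sum>r\<in>Q N. prob (A q \<inter> A r)) \<le> (1 + \<epsilon>) * E N ^ 2 + C * E N"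
        using second[OF \<epsilon>] by blast
      have "\<forall>\<^sub>F N in sequentially. E N \<ge> max (max 1 (2 * real K)) (C / \<epsilon>)"
        using E unfolding filterlim_at_top by blast
      then obtain N where N: "E N \<ge> max (max 1 (2 * real K)) (C / \<epsilon>)" by (auto simp: eventually_sequentially)
      \<comment> \<open>The first bound allows division by \<open>E N\<close>, the second makes
        points of \<open>B K\<close> deviate from the mean by at least \<open>E N / 2\<close>, the
        third absorbs the linear term of the variance.\<close>
      have E1: "E N \<ge> 1" "E N \<ge> 2 * real K" "C \<le> \<epsilon> * E N" using N \<epsilon> by (auto simp: field_simps)
      have var: "variance (S N) \<le> 2 * \<epsilon> * E N ^ 2"
      proof -
        have "variance (S N) = expectation (\<lambda>x. S N x ^ 2) - E N ^ 2"
          using variance_eq[OF int1 int2] by (simp add: expS)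
        also have "\<dots> \<le> \<epsilon> * E N ^ 2 + C * E N" using C[of N] by (simp add: expSS algebra_simps)
        also have "C * E N \<le> (\<epsilon> * E N) * E N" using E1 by (intro mult_right_mono) auto
        finally show ?thesis by (simp add: power2_eq_square)
      qed
      have "prob (B K) \<le> prob {x \<in> space M. E N / 2 \<le> \<bar>S N x - expectation (S N)\<bar>}"
      proof (rule finite_measure_mono)
        show "B K \<subseteq> {x \<in> space M. E N / 2 \<le> \<bar>S N x - expectation (S N)\<bar>}"
        proof
          fix x assume x: "x \<in> B K"
          then have "S N x \<le> real K" by (simp add: B_def)
          then have "E N / 2 \<le> \<bar>S N x - E N\<bar>" using E1 by linarith
          then show "x \<in> {x \<in> space M. E N / 2 \<le> \<bar>S N x - expectation (S N)\<bar>}"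
            using x by (simp add: B_def expS)
        qed
      qed measurable
      also have "\<dots> \<le> variance (S N) / (E N / 2) ^ 2"
        using E1 by (intro Chebyshev_inequality int2) auto
      also have "\<dots> \<le> 2 * \<epsilon> * E N ^ 2 / (E N / 2) ^ 2" by (intro divide_right_mono var) simp
      also have "\<dots> = 8 * \<epsilon>" using E1 by (simp add: power2_eq_square)
      finally show ?thesis .
    qed
    from this[of "e / 8" for e] have "prob (B K) \<le> 0 + e" if "e > 0" for e using that by simp
    then have "prob (B K) \<le> 0" by (rule field_le_epsilon)
    then show ?thesis by (simp add: measure_le_0_iff)
  qed
  have "AE x in M. x \<notin> B K" for K
    using B0[of K] by (intro AE_not_in) (simp add: null_setsI emeasure_eq_measure)
  then have "AE x in M. \<forall>K. x \<notin> B K" by (simp add: AE_all_countable)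
  then show ?thesis
  proof (rule AE_mp, intro AE_I2 impI notI)
    fix x assume x: "x \<in> space M" and nB: "\<forall>K. x \<notin> B K" and fin: "finite {q \<in> (\<Union>N. Q N). x \<in> A q}"
    have "S N x \<le> real (card {q \<in> (\<Union>N. Q N). x \<in> A q})" for N
    proof -
      have "S N x = real (card {q \<in> Q N. x \<in> A q})"
        using Q by (simp add: S_def indicator_def of_bool_def sum.If_cases Int_def)
      also have "\<dots> \<le> real (card {q \<in> (\<Union>N. Q N). x \<in> A q})"
        using fin by (intro of_nat_mono card_mono) auto
      finally show ?thesis .
    qed
    then have "x \<in> B (card {q \<in> (\<Union>N. Q N). x \<in> A q})" using x by (simp add: B_def)
    then show False using nB by simp
  qed
qed

section \<open>The Khintchine--Groshev theorem\<close>

text \<open>Norm balls contain finitely many integer vectors. The unbounded form presents the limsup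
  set as a countable intersection of countable unions.\<close>

lemma infinite_int_vec_iff:
  fixes X :: "(int ^ 'n::finite) set"
  shows "infinite X \<longleftrightarrow> (\<forall>N. \<exists>q\<in>X. N < supnorm_int q)"
proof
  assume inf: "infinite X"
  show "\<forall>N. \<exists>q\<in>X. N < supnorm_int q"
  proof (rule ccontr)
    assume "\<not> (\<forall>N. \<exists>q\<in>X. N < supnorm_int q)"
    then obtain N where "X \<subseteq> {q. supnorm_int q \<le> N}" by (auto simp: not_less)
    then show False using inf finite_supnorm_int_ball finite_subset by blast
  qed
next
  assume unb: "\<forall>N. \<exists>q\<in>X. N < supnorm_int q"
  show "infinite X"
  proof
    assume "finite X"
    then have "supnorm_int q \<le> Max (supnorm_int ` X)" if "q \<in> X" for q using that by simp
    then show False using unb by (meson not_less)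
  qed
qed

definition approx_rows :: "(nat \<Rightarrow> real) \<Rightarrow> real ^ 'm::finite \<Rightarrow> real ^ 'm ^ 'n::finite \<Rightarrow> (int ^ 'n) set" where
  "approx_rows \<psi> y x = {q. q \<noteq> 0 \<and> x \<in> approx_set y (\<psi> (supnorm_int q)) q}"

lemma closed_cube_eq_cbox:
  "{x :: real ^ 'm::finite ^ 'n::finite. \<forall>i j. 0 \<le> x $ i $ j \<and> x $ i $ j \<le> 1} = cbox 0 One"
proof -
  have "x \<in> cbox 0 One \<longleftrightarrow> (\<forall>b\<in>Basis. 0 \<le> x \<bullet> b \<and> x \<bullet> b \<le> 1)" for x :: "real ^ 'm ^ 'n"
    by (simp add: mem_box)
  moreover have "(\<forall>b\<in>Basis. 0 \<le> x \<bullet> b \<and> x \<bullet> b \<le> 1) \<longleftrightarrow> (\<forall>i j. 0 \<le> x $ i $ j \<and> x $ i $ j \<le> 1)" for x :: "real ^ 'm ^ 'n"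
    by (auto simp: Basis_vec_def inner_axis)
  ultimately show ?thesis by blast
qed

text \<open>For given \<open>x\<close> and \<open>q\<close> every coordinate of \<open>p\<close> is
  confined to a bounded interval, so each \<open>q\<close> occurs with finitely many
  \<open>p\<close>, and counting pairs or counting \<open>q\<close> makes no difference to
  infinitude.\<close>

lemma A_set_eq:
  fixes y :: "real ^ 'm::finite"
  assumes \<psi>: "\<And>q. \<psi> q \<ge> 0"
  shows "(A_set \<psi> y :: (real ^ 'm ^ 'n::finite) set) = cbox 0 One \<inter> {x. infinite (approx_rows \<psi> y x)}"
proof -
  have "infinite {(p :: int ^ 'm, q :: int ^ 'n). q \<noteq> 0 \<and>
        (\<forall>j. \<bar>rowmul q x $ j + of_int (p $ j) - y $ j\<bar> < \<psi> (supnorm_int q))}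
      \<longleftrightarrow> infinite (approx_rows \<psi> y x)" (is "infinite ?P \<longleftrightarrow> _") for x :: "real ^ 'm ^ 'n"
  proof -
    let ?F = "\<lambda>q j. {p::int. \<bar>rowmul q x $ j + of_int p - y $ j\<bar> < \<psi> (supnorm_int q)}"
    have finF: "finite (?F q j)" for q j
    proof -
      let ?\<alpha> = "y $ j - rowmul q x $ j - \<psi> (supnorm_int q)"
      have "?F q j \<subseteq> {N. ?\<alpha> < of_int N \<and> of_int N < ?\<alpha> + 2 * \<psi> (supnorm_int q)}" by auto
      then show ?thesis
        by (rule finite_subset) (intro card_int_open_interval, simp add: \<psi>)
    qed
    have "approx_rows \<psi> y x = snd ` ?P"
    proof (intro equalityI subsetI)
      fix q assume q: "q \<in> approx_rows \<psi> y x"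
      then have "\<forall>j. \<exists>p. p \<in> ?F q j" by (simp add: approx_rows_def approx_set_def mod1_ball_def)
      then obtain p where "\<forall>j. p j \<in> ?F q j" by metis
      then have "(vec_lambda p, q) \<in> ?P" using q by (simp add: approx_rows_def)
      then show "q \<in> snd ` ?P" by (rule image_eqI[rotated]) simp
    qed (auto simp: approx_rows_def approx_set_def mod1_ball_def, blast)
    moreover have "?P \<subseteq> (\<Union>q\<in>snd ` ?P. {p. \<forall>j. p $ j \<in> ?F q j} \<times> {q})" by auto
    moreover have "finite {p :: int ^ 'm. \<forall>j. p $ j \<in> ?F q j}" for q
      by (rule card_vec_box(2)) (rule finF)
    ultimately show ?thesis
      by (metis (no_types, lifting) finite_SigmaI finite_UN_I finite.emptyI finite_imageI finite_insert finite_subset)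
  qed
  then show ?thesis unfolding A_set_def closed_cube_eq_cbox[symmetric] by blast
qed

lemma infinite_approx_rows_measurable [measurable]:
  "{x :: real ^ 'm::finite ^ 'n::finite. infinite (approx_rows \<psi> y x)} \<in> sets borel"
proof -
  have "{x :: real ^ 'm ^ 'n. infinite (approx_rows \<psi> y x)} =
      (\<Inter>N. \<Union>q\<in>{q. q \<noteq> 0 \<and> N < supnorm_int q}. approx_set y (\<psi> (supnorm_int q)) q)"
    by (auto simp: infinite_int_vec_iff approx_rows_def)
  also have "\<dots> \<in> sets borel"
    by (intro sets.countable_INT sets.countable_UN') auto
  finally show ?thesis .
qed

text \<open>The terms tend to 0 and the factor \<open>real (Suc q) ^ k\<close> is at least 1. This
  gives access to the exact measure formula in the convergence case and justifies truncating \<psi>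
  in the divergence case.\<close>

lemma eventually_less_half_of_summable:
  fixes \<psi> :: "nat \<Rightarrow> real"
  assumes "summable (\<lambda>q. real (Suc q) ^ k * \<psi> (Suc q) ^ m)" and \<psi>: "\<And>q. \<psi> q \<ge> 0"
  shows "\<forall>\<^sub>F q in sequentially. \<psi> (Suc q) < 1 / 2"
proof -
  have "\<forall>\<^sub>F q in sequentially. real (Suc q) ^ k * \<psi> (Suc q) ^ m < (1 / 2) ^ m"
    using summable_LIMSEQ_zero[OF assms(1)] by (rule order_tendstoD) simp
  then show ?thesis
  proof eventually_elim
    case (elim q)
    have "1 * \<psi> (Suc q) ^ m \<le> real (Suc q) ^ k * \<psi> (Suc q) ^ m"
      by (intro mult_right_mono one_le_power zero_le_power \<psi>) simp
    then have "\<psi> (Suc q) ^ m < (1 / 2) ^ m" using elim by simp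
    then show ?case by (rule power_less_imp_less_base) simp
  qed
qed

section \<open>The convergence half\<close>

text \<open>Borel-Cantelli, with all vectors of one norm merged into a single event: the sphere of
  norm s has O(s^(n-1)) vectors, each contributing measure \<open>(2 * \<psi> s) ^ m\<close>, which
  reproduces the terms of the series.\<close>

lemma AE_finite_approx_rows:
  fixes \<psi> :: "nat \<Rightarrow> real" and y :: "real ^ 'm::finite"
  assumes \<psi>: "\<And>q. \<psi> q \<ge> 0"
    and sum: "summable (\<lambda>q. real (Suc q) ^ (CARD('n) - 1) * \<psi> (Suc q) ^ CARD('m))"
  shows "AE x in lborel. x \<in> unit_cube \<longrightarrow> finite (approx_rows \<psi> y (x :: real ^ 'm ^ 'n::finite))"
proof -
  let ?n = "CARD('n)" and ?m = "CARD('m)"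
  let ?K = "2 * real ?n * 3 ^ (?n - 1) * 2 ^ ?m"
  \<comment> \<open>Index \<open>s\<close> stands for norm \<open>Suc s\<close>, which excludes the
    zero vector and matches the indexing of the series.\<close>
  define B :: "nat \<Rightarrow> (real ^ 'm ^ 'n) set" where
    "B s = (\<Union>q\<in>{q. supnorm_int q = Suc s}. approx_set y (\<psi> (Suc s)) q \<inter> unit_cube)" for s
  have B [measurable]: "B s \<in> sets borel" for s
    unfolding B_def by (intro sets.finite_UN) auto
  have fin: "emeasure lborel (B s) < \<infinity>" for s
  proof -
    have "emeasure lborel (B s) \<le> emeasure lborel (unit_cube :: (real ^ 'm ^ 'n) set)"
      by (rule emeasure_mono) (auto simp: B_def)
    then show ?thesis by (simp add: emeasure_unit_cube order_le_less_trans)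
  qed
  have "\<forall>\<^sub>F s in sequentially. norm (measure lborel (B s)) \<le> ?K * (real (Suc s) ^ (?n - 1) * \<psi> (Suc s) ^ ?m)"
    using eventually_less_half_of_summable[OF sum \<psi>]
  proof eventually_elim
    case (elim s)
    have "measure lborel (B s)
        \<le> (\<Sum>q\<in>{q :: int ^ 'n. supnorm_int q = Suc s}. measure lborel (approx_set y (\<psi> (Suc s)) q \<inter> unit_cube))"
      unfolding B_def
    proof (rule measure_UNION_le)
      fix q :: "int ^ 'n" assume "q \<in> {q. supnorm_int q = Suc s}"
      show "approx_set y (\<psi> (Suc s)) q \<inter> unit_cube \<in> sets lborel" by simp
    qed simp
    also have "\<dots> = (\<Sum>q\<in>{q :: int ^ 'n. supnorm_int q = Suc s}. (2 * \<psi> (Suc s)) ^ ?m)"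
    proof (rule sum.cong)
      fix q :: "int ^ 'n" assume "q \<in> {q. supnorm_int q = Suc s}"
      then have "q \<noteq> 0" using supnorm_int_eq_0_iff[of q] by auto
      then show "measure lborel (approx_set y (\<psi> (Suc s)) q \<inter> unit_cube) = (2 * \<psi> (Suc s)) ^ ?m"
        using elim \<psi> by (simp add: measure_def emeasure_approx_set)
    qed simp
    also have "\<dots> = real (card {q :: int ^ 'n. supnorm_int q = Suc s}) * (2 * \<psi> (Suc s)) ^ ?m" by simp
    also have "\<dots> \<le> (2 * real ?n * 3 ^ (?n - 1) * real (Suc s) ^ (?n - 1)) * (2 * \<psi> (Suc s)) ^ ?m"
      using card_supnorm_int_sphere(2)[where 'n = 'n, of "Suc s"] \<psi> by (intro mult_right_mono) auto
    finally show ?case by (simp add: power_mult_distrib mult_ac)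
  qed
  \<comment> \<open>The bound holds only where the radius is below 1/2, that is, for all but
    finitely many norms; comparison of series needs no more.\<close>
  then have "summable (\<lambda>s. measure lborel (B s))"
    by (rule summable_comparison_test_ev) (intro summable_mult sum)
  then have "AE x in lborel. \<forall>\<^sub>F s in sequentially. x \<in> space lborel - B s"
    by (intro borel_cantelli_AE1) (auto simp: fin[simplified] B)
  then show ?thesis
  proof eventually_elim
    case (elim x)
    then obtain N where N: "\<And>s. s \<ge> N \<Longrightarrow> x \<notin> B s" by (auto simp: eventually_sequentially)
    show ?case
    proof (rule impI, rule ccontr)
      assume x: "x \<in> unit_cube" and "infinite (approx_rows \<psi> y x)"
      then obtain q where q: "q \<in> approx_rows \<psi> y x" "N < supnorm_int q" by (auto simp: infinite_int_vec_iff)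
      have "x \<in> B (supnorm_int q - 1)" using q x by (auto simp: B_def approx_rows_def)
      moreover have "x \<notin> B (supnorm_int q - 1)" using q by (intro N) auto
      ultimately show False by simp
    qed
  qed
qed

section \<open>The divergence half\<close>

text \<open>The second moment criterion on the unit cube as a probability space, with the nonzero
  vectors of norm at most \<open>N\<close> as \<open>N\<close>-th stage.\<close>

lemma AE_infinite_approx_rows:
  fixes \<psi> :: "nat \<Rightarrow> real" and y :: "real ^ 'm::finite"
  assumes nm: "CARD('n::finite) + CARD('m) \<ge> 4"
    and \<psi>: "\<And>q. \<psi> q \<ge> 0" "\<And>q. \<psi> q \<le> 1 / 2"
    and nsum: "\<not> summable (\<lambda>q. real (Suc q) ^ (CARD('n) - 1) * \<psi> (Suc q) ^ CARD('m))"
  shows "AE x in lborel. x \<in> unit_cube \<longrightarrow> infinite (approx_rows \<psi> y (x :: real ^ 'm ^ 'n))"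
proof -
  let ?n = "CARD('n)" and ?m = "CARD('m)"
  let ?K = "8 * real ?n * 3 ^ (?n - 1)"
  define M :: "(real ^ 'm ^ 'n) measure" where "M = restrict_space lborel unit_cube"
  define \<alpha> where "\<alpha> s = (2 * \<psi> s) ^ ?m" for s
  have \<alpha>0: "\<alpha> s \<ge> 0" for s using \<psi> by (simp add: \<alpha>_def)
  define A :: "int ^ 'n \<Rightarrow> (real ^ 'm ^ 'n) set" where
    "A q = approx_set y (\<psi> (supnorm_int q)) q \<inter> unit_cube" for q
  define Q :: "nat \<Rightarrow> (int ^ 'n) set" where "Q N = {q. q \<noteq> 0 \<and> supnorm_int q \<le> N}" for N
  define E where "E N = (\<Sum>q\<in>Q N. \<alpha> (supnorm_int q))" for N
  interpret prob_space M
    by (rule prob_spaceI) (simp add: M_def emeasure_restrict_space emeasure_unit_cube)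
  have finQ [simp]: "finite (Q N)" for N
    unfolding Q_def by (rule finite_subset[OF _ finite_supnorm_int_ball[of N]]) auto
  have evA: "A q \<in> events" for q
    unfolding M_def A_def by (auto simp: sets_restrict_space_iff)
  have probM: "prob D = measure lborel D" if "D \<subseteq> unit_cube" for D
    using that by (simp add: M_def measure_restrict_space)
  have probA: "prob (A q) = \<alpha> (supnorm_int q)" if "q \<noteq> 0" for q
  proof -
    have "emeasure lborel (A q) = ennreal (\<alpha> (supnorm_int q))"
      unfolding A_def \<alpha>_def by (rule emeasure_approx_set[OF that \<psi>])
    then have "measure lborel (A q) = \<alpha> (supnorm_int q)"
      by (rule measure_eq_emeasure_eq_ennreal[OF \<alpha>0])
    then show ?thesis by (subst probM) (auto simp: A_def)
  qed
  have by_norm: "(\<Sum>q\<in>Q N. h q) = (\<Sum>s\<in>{1..N}. \<Sum>q | supnorm_int q = s. h q)" for N and h :: "int ^ 'n \<Rightarrow> real"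
  proof -
    have "(\<Sum>s\<in>{1..N}. sum h {q \<in> Q N. supnorm_int q = s}) = (\<Sum>q\<in>Q N. h q)"
      by (rule sum.group) (auto simp: Q_def Suc_le_eq simp flip: neq0_conv)
    moreover have "{q \<in> Q N. supnorm_int q = s} = {q. supnorm_int q = s}" if "s \<in> {1..N}" for s
      using that by (auto simp: Q_def)
    ultimately show ?thesis by simp
  qed
  have E_eq: "E N = (\<Sum>s\<in>{1..N}. real (card {q :: int ^ 'n. supnorm_int q = s}) * \<alpha> s)" for N
    by (simp add: E_def by_norm)

  \<comment> \<open>The lower count of spheres and \<open>\<alpha> s \<ge> \<psi> s ^ m\<close> make
    \<open>E N\<close> dominate the partial sums of the series, which are unbounded because its
    terms are nonnegative.\<close>
  have E_top: "filterlim E at_top sequentially"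
  proof -
    have mono: "E N \<le> E N'" if "N \<le> N'" for N N'
      unfolding E_def using that \<alpha>0 by (intro sum_mono2) (auto simp: Q_def)
    have "\<exists>N. Z \<le> E N" for Z
    proof (rule ccontr)
      assume "\<not> (\<exists>N. Z \<le> E N)"
      then have bd: "E N \<le> Z" for N by (auto simp: not_le less_imp_le)
      have "summable (\<lambda>q. real (Suc q) ^ (?n - 1) * \<psi> (Suc q) ^ ?m)"
      proof (rule bounded_imp_summable)
        fix N
        have "(\<Sum>q\<le>N. real (Suc q) ^ (?n - 1) * \<psi> (Suc q) ^ ?m)
            = (\<Sum>s\<in>{1..Suc N}. real s ^ (?n - 1) * \<psi> s ^ ?m)"
          by (simp only: atLeast0AtMost[symmetric] One_nat_def sum.shift_bounds_cl_Suc_ivl)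
        also have "\<dots> \<le> (\<Sum>s\<in>{1..Suc N}. real (card {q :: int ^ 'n. supnorm_int q = s}) * \<alpha> s)"
          using \<psi> unfolding \<alpha>_def
          by (intro sum_mono mult_mono power_mono card_supnorm_int_sphere(1)) auto
        also have "\<dots> \<le> Z" using bd[of "Suc N"] by (simp only: E_eq)
        finally show "(\<Sum>q\<le>N. real (Suc q) ^ (?n - 1) * \<psi> (Suc q) ^ ?m) \<le> Z" .
      qed (use \<psi> in auto)
      then show False using nsum by blast
    qed
    then show ?thesis
      unfolding filterlim_at_top eventually_sequentially using mono order_trans by meson
  qed

  \<comment> \<open>On a sphere \<alpha> is constant, so the sphere estimate for the weights applies
    norm by norm; the lower count turns its bound back into a multiple of the number of vectors,
    hence of \<open>E N\<close>.\<close>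
  have error: "(\<Sum>q\<in>Q N. \<alpha> (supnorm_int q) * (\<Sum>r\<in>Q N. parallel_weight ?m q r)) \<le> ?K * E N" for N
  proof -
    have "(\<Sum>q\<in>Q N. \<alpha> (supnorm_int q) * (\<Sum>r\<in>Q N. parallel_weight ?m q r))
      = (\<Sum>s\<in>{1..N}. \<alpha> s * (\<Sum>q | supnorm_int q = s. \<Sum>r\<in>Q N. parallel_weight ?m q r))"
      unfolding by_norm sum_distrib_left by simp
    also have "\<dots> \<le> (\<Sum>s\<in>{1..N}. \<alpha> s * (?K * real (card {q :: int ^ 'n. supnorm_int q = s})))"
    proof (intro sum_mono mult_left_mono \<alpha>0)
      fix s assume s: "s \<in> {1..N}"
      have "(\<Sum>q | supnorm_int q = s. \<Sum>r\<in>Q N. parallel_weight ?m (q :: int ^ 'n) r) \<le> ?K * real s ^ (?n - 1)"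
        using s nm by (intro sum_sphere_parallel_weight_le) auto
      also have "\<dots> \<le> ?K * real (card {q :: int ^ 'n. supnorm_int q = s})"
        using s by (intro mult_left_mono card_supnorm_int_sphere(1)) auto
      finally show "(\<Sum>q | supnorm_int q = s. \<Sum>r\<in>Q N. parallel_weight ?m (q :: int ^ 'n) r)
        \<le> ?K * real (card {q :: int ^ 'n. supnorm_int q = s})" .
    qed
    also have "\<dots> = ?K * E N" by (simp add: E_eq sum_distrib_left mult_ac)
    finally show ?thesis .
  qed

  have "AE x in M. infinite {q \<in> (\<Union>N. Q N). x \<in> A q}"
  proof (rule AE_infinitely_often_of_second_moment)
    have E_prob: "(\<Sum>q\<in>Q N. prob (A q)) = E N" for N
      unfolding E_def by (intro sum.cong refl probA) (auto simp: Q_def)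
    show "filterlim (\<lambda>N. \<Sum>q\<in>Q N. prob (A q)) at_top sequentially"
      unfolding E_prob by (rule E_top)
    fix \<epsilon> :: real assume \<epsilon>: "\<epsilon> > 0"
    obtain C where C0: "C \<ge> 0" and C: "\<And>x y :: real. 0 \<le> x \<Longrightarrow> 0 \<le> y \<Longrightarrow>
        (x + y) ^ ?m \<le> (1 + \<epsilon>) * x ^ ?m + C * y ^ ?m"
      using power_add_le_eps[OF \<epsilon>, of ?m] by blast
    \<comment> \<open>Taking \<open>q\<close> as the longer vector leaves at most
      \<open>2 * a\<close> multipliers \<open>b\<close> for each \<open>a\<close>, which is what
      makes the weights summable.\<close>
    have ordered: "prob (A q \<inter> A r) \<le> (1 + \<epsilon>) * (\<alpha> (supnorm_int q) * \<alpha> (supnorm_int r))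
        + C * (\<alpha> (supnorm_int q) * parallel_weight ?m q r)"
      if q: "q \<noteq> 0" and r: "r \<noteq> 0" and le: "supnorm_int r \<le> supnorm_int q" for q r
    proof -
      let ?\<rho> = "\<psi> (supnorm_int q)" and ?\<rho>' = "\<psi> (supnorm_int r)"
      obtain \<kappa> :: real where \<kappa>: "(\<exists>i k. q $ i * r $ k \<noteq> q $ k * r $ i) \<and> \<kappa> = 0 \<or>
          (\<exists>a b u. u \<noteq> 0 \<and> a > 0 \<and> coprime (int a) b \<and> q = int a *s u \<and> r = b *s u \<and> \<kappa> = 1 / real a)"
        using int_vec_dependence_cases[OF q, of r] by metis
      have \<kappa>0: "\<kappa> \<ge> 0" using \<kappa> by auto
      \<comment> \<open>Zero for independent pairs, as \<open>m\<close> is positive; for parallel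
        pairs it is one summand of the weight.\<close>
      have weight: "\<kappa> ^ ?m \<le> parallel_weight ?m q r"
        using \<kappa>
      proof (elim disjE conjE exE)
        assume "\<kappa> = 0"
        then show ?thesis by (simp add: parallel_weight_nonneg zero_power)
      next
        fix a b u assume "u \<noteq> 0" "0 < a" "q = int a *s u" "r = b *s u" "\<kappa> = 1 / real a"
        then show ?thesis using parallel_weight_ge[of u a q r b ?m] r le by (simp add: power_one_over)
      qed
      have "A q \<inter> A r = approx_set y ?\<rho> q \<inter> approx_set y ?\<rho>' r \<inter> unit_cube" by (auto simp: A_def)
      then have "emeasure lborel (A q \<inter> A r) \<le> ennreal ((2 * ?\<rho> * (2 * ?\<rho>' + \<kappa>)) ^ ?m)"
        using emeasure_approx_set_overlap[OF r \<psi> \<psi> \<kappa>] by simp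
      then have "measure lborel (A q \<inter> A r) \<le> (2 * ?\<rho> * (2 * ?\<rho>' + \<kappa>)) ^ ?m"
        using \<psi> \<kappa>0 by (simp add: measure_def enn2real_leI)
      then have "prob (A q \<inter> A r) \<le> (2 * ?\<rho> * (2 * ?\<rho>' + \<kappa>)) ^ ?m"
        by (subst probM) (auto simp: A_def)
      also have "\<dots> = (2 * ?\<rho> * (2 * ?\<rho>') + 2 * ?\<rho> * \<kappa>) ^ ?m" by (simp add: distrib_left)
      also have "\<dots> \<le> (1 + \<epsilon>) * (2 * ?\<rho> * (2 * ?\<rho>')) ^ ?m + C * (2 * ?\<rho> * \<kappa>) ^ ?m"
        using \<psi> \<kappa>0 by (intro C) auto
      also have "\<dots> = (1 + \<epsilon>) * (\<alpha> (supnorm_int q) * \<alpha> (supnorm_int r)) + C * (\<alpha> (supnorm_int q) * \<kappa> ^ ?m)"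
        by (simp only: \<alpha>_def power_mult_distrib)
      also have "\<dots> \<le> (1 + \<epsilon>) * (\<alpha> (supnorm_int q) * \<alpha> (supnorm_int r))
          + C * (\<alpha> (supnorm_int q) * parallel_weight ?m q r)"
        by (intro add_left_mono mult_left_mono weight C0 \<alpha>0)
      finally show ?thesis .
    qed
    \<comment> \<open>Adding the errors of both orders gives a bound valid for every pair; it only
      doubles the total, since the second double sum is the first with \<open>q\<close> and
      \<open>r\<close> exchanged.\<close>
    have pair: "prob (A q \<inter> A r) \<le> (1 + \<epsilon>) * (\<alpha> (supnorm_int q) * \<alpha> (supnorm_int r))
        + (C * (\<alpha> (supnorm_int q) * parallel_weight ?m q r) + C * (\<alpha> (supnorm_int r) * parallel_weight ?m r q))"
      if "q \<in> Q N" "r \<in> Q N" for q r N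
    proof -
      have nn: "C * (\<alpha> (supnorm_int q) * parallel_weight ?m q r) \<ge> 0"
        "C * (\<alpha> (supnorm_int r) * parallel_weight ?m r q) \<ge> 0"
        by (intro mult_nonneg_nonneg C0 \<alpha>0 parallel_weight_nonneg)+
      have nz: "q \<noteq> 0" "r \<noteq> 0" using that by (auto simp: Q_def)
      show ?thesis
      proof (cases "supnorm_int r \<le> supnorm_int q")
        case True
        from ordered[OF nz True] nn show ?thesis by linarith
      next
        case False
        then have "supnorm_int q \<le> supnorm_int r" by simp
        from ordered[OF nz(2,1) this] nn show ?thesis by (simp add: Int_commute mult.commute)
      qed
    qed
    have "(\<Sum>q\<in>Q N. \<Sum>r\<in>Q N. prob (A q \<inter> A r)) \<le> (1 + \<epsilon>) * E N ^ 2 + (2 * C * ?K) * E N" for N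
    proof -
      let ?W = "\<lambda>q r. \<alpha> (supnorm_int q) * parallel_weight ?m q r"
      have "(\<Sum>q\<in>Q N. \<Sum>r\<in>Q N. prob (A q \<inter> A r))
        \<le> (\<Sum>q\<in>Q N. \<Sum>r\<in>Q N. (1 + \<epsilon>) * (\<alpha> (supnorm_int q) * \<alpha> (supnorm_int r)) + (C * ?W q r + C * ?W r q))"
        by (intro sum_mono pair)
      also have "\<dots> = (1 + \<epsilon>) * (\<Sum>q\<in>Q N. \<Sum>r\<in>Q N. \<alpha> (supnorm_int q) * \<alpha> (supnorm_int r))
          + (C * (\<Sum>q\<in>Q N. \<Sum>r\<in>Q N. ?W q r) + C * (\<Sum>q\<in>Q N. \<Sum>r\<in>Q N. ?W r q))"
        by (simp only: sum.distrib sum_distrib_left)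
      also have "(\<Sum>q\<in>Q N. \<Sum>r\<in>Q N. ?W r q) = (\<Sum>q\<in>Q N. \<Sum>r\<in>Q N. ?W q r)"
        by (rule sum.swap)
      also have "(\<Sum>q\<in>Q N. \<Sum>r\<in>Q N. \<alpha> (supnorm_int q) * \<alpha> (supnorm_int r)) = E N ^ 2"
        by (simp only: E_def power2_eq_square sum_product)
      also have "(\<Sum>q\<in>Q N. \<Sum>r\<in>Q N. ?W q r) = (\<Sum>q\<in>Q N. \<alpha> (supnorm_int q) * (\<Sum>r\<in>Q N. parallel_weight ?m q r))"
        by (simp only: sum_distrib_left)
      also have "C * \<dots> \<le> C * (?K * E N)" by (intro mult_left_mono error C0)
      finally show ?thesis by (simp add: algebra_simps)
    qed
    then show "\<exists>C. \<forall>N. (\<Sum>q\<in>Q N. \<Sum>r\<in>Q N. prob (A q \<inter> A r))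
        \<le> (1 + \<epsilon>) * (\<Sum>q\<in>Q N. prob (A q))\<^sup>2 + C * (\<Sum>q\<in>Q N. prob (A q))"
      unfolding E_prob by blast
  qed (auto intro: evA)
  moreover have "{q \<in> (\<Union>N. Q N). x \<in> A q} = approx_rows \<psi> y x" if "x \<in> unit_cube" for x
    using that by (auto simp: Q_def A_def approx_rows_def)
  ultimately show ?thesis
    unfolding M_def by (subst (asm) AE_restrict_space_iff) auto
qed

theorem theorem1:
  fixes \<psi> :: "nat \<Rightarrow> real" and y :: "real ^ 'm::finite"
  assumes "CARD('n::finite) * CARD('m) > 2"
    and "\<And>q. \<psi> q \<ge> 0"
  shows "(A_set \<psi> y :: (real ^ 'm ^ 'n) set) \<in> sets lebesgue \<and>
    (summable (\<lambda>q. real (Suc q) ^ (CARD('n) - 1) * \<psi> (Suc q) ^ CARD('m))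
       \<longrightarrow> measure lebesgue (A_set \<psi> y :: (real ^ 'm ^ 'n) set) = 0) \<and>
    (\<not> summable (\<lambda>q. real (Suc q) ^ (CARD('n) - 1) * \<psi> (Suc q) ^ CARD('m))
       \<longrightarrow> measure lebesgue (A_set \<psi> y :: (real ^ 'm ^ 'n) set) = 1)"
proof (intro conjI impI)
  let ?n = "CARD('n)" and ?m = "CARD('m)"
  let ?A = "A_set \<psi> y :: (real ^ 'm ^ 'n) set"
  let ?cb = "cbox 0 One :: (real ^ 'm ^ 'n) set"
  \<comment> \<open>The pairs with n + m \<le> 3 are (1,1), (1,2) and (2,1), whose products are at
    most 2.\<close>
  have nm: "?n + ?m \<ge> 4"
  proof (rule ccontr)
    assume "\<not> ?n + ?m \<ge> 4"
    moreover have "?n > 0" "?m > 0" by simp_all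
    ultimately have "?n = 1 \<and> ?m \<le> 2 \<or> ?m = 1 \<and> ?n \<le> 2" by linarith
    then show False using assms(1) by auto
  qed
  have A_eq: "?A = ?cb \<inter> {x. infinite (approx_rows \<psi> y x)}"
    by (rule A_set_eq) (rule assms(2))
  have A_borel [measurable]: "?A \<in> sets borel" unfolding A_eq by measurable
  then show "?A \<in> sets lebesgue" by simp
  have meas: "measure lebesgue ?A = measure lborel ?A" by (simp add: measure_completion)
  have cb: "emeasure lborel ?cb = 1" by (subst emeasure_lborel_cbox) auto
  \<comment> \<open>The problem lives on the closed cube, the averaging on the half-open one; they
    differ by a null set.\<close>
  have "unit_cube \<subseteq> ?cb" by (auto simp: unit_cube_def mem_box less_imp_le)
  then have "emeasure lborel (?cb - unit_cube) = 0"
    by (subst emeasure_Diff) (auto simp: emeasure_unit_cube cb)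
  then have "AE x in lborel. x \<notin> ?cb - unit_cube" by (intro AE_not_in) (simp add: null_setsI)
  then have cube: "AE x in lborel. x \<in> ?cb \<longleftrightarrow> x \<in> unit_cube"
    by eventually_elim (use \<open>unit_cube \<subseteq> ?cb\<close> in auto)
  {
    assume sum: "summable (\<lambda>q. real (Suc q) ^ (?n - 1) * \<psi> (Suc q) ^ ?m)"
    have "AE x in lborel. x \<notin> ?A"
      using cube AE_finite_approx_rows[OF assms(2) sum, of y] by eventually_elim (auto simp: A_eq)
    then have "emeasure lborel ?A = 0" by (subst (asm) AE_iff_measurable[of ?A]) auto
    then show "measure lebesgue ?A = 0" by (simp add: meas measure_def)
  next
    assume nsum: "\<not> summable (\<lambda>q. real (Suc q) ^ (?n - 1) * \<psi> (Suc q) ^ ?m)"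
    \<comment> \<open>Truncation brings the radii into the range of the measure formula and can only
      shrink the limsup set.\<close>
    define \<phi> where "\<phi> q = min (\<psi> q) (1 / 2)" for q
    have \<phi>: "\<phi> q \<ge> 0" "\<phi> q \<le> 1 / 2" for q using assms(2) by (auto simp: \<phi>_def)
    \<comment> \<open>If the truncated series converged, its radii would eventually be below 1/2 and
      hence equal to the original ones, so the original series would converge too.\<close>
    have "\<not> summable (\<lambda>q. real (Suc q) ^ (?n - 1) * \<phi> (Suc q) ^ ?m)"
    proof
      assume s: "summable (\<lambda>q. real (Suc q) ^ (?n - 1) * \<phi> (Suc q) ^ ?m)"
      from eventually_less_half_of_summable[OF this \<phi>(1)]
      have "\<forall>\<^sub>F q in sequentially. real (Suc q) ^ (?n - 1) * \<phi> (Suc q) ^ ?m = real (Suc q) ^ (?n - 1) * \<psi> (Suc q) ^ ?m"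
        by eventually_elim (auto simp: \<phi>_def min_def split: if_splits)
      from summable_cong[OF this] s nsum show False by simp
    qed
    note AE = AE_infinite_approx_rows[OF nm \<phi> this, of y]
    have sub: "approx_rows \<phi> y x \<subseteq> approx_rows \<psi> y x" for x :: "real ^ 'm ^ 'n"
      by (fastforce simp: approx_rows_def approx_set_def mod1_ball_def \<phi>_def)
    have "AE x in lborel. x \<in> ?A \<longleftrightarrow> x \<in> ?cb"
      using cube AE by eventually_elim (auto simp: A_eq dest: finite_subset[OF sub])
    then have "emeasure lborel ?A = emeasure lborel ?cb" by (intro emeasure_eq_AE) auto
    then show "measure lebesgue ?A = 1" by (simp add: meas measure_def cb)
  }
qed

end
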